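(* Let $q$ be a prime power, let $t\geq 2$ be a fixed integer, and let $0<\theta<1-q^{-t}$ be rational. Then for every sufficiently large length $n$ there is a linear code $C_n\leq\mathbb F_q^n$ satisfying \[ R_t(C_n)\leq\theta n, \qquad \dim_{\mathbb F_q}C_n\leq n\bigl(1-H_{q^t}(\theta)\bigr)+O(\log n), \] where the implied constant depends only on $q$, $t$, and $\theta$.
   Context: For an integer $Q\ge 2$ and $x\in[0,1]$, the $Q$-ary entropy function is $H_Q(x):=x\log_Q(Q-1)-x\log_Q x-(1-x)\log_Q(1-x)$, with $0\log_Q 0=0$. $C\le\mathbb F_q^n$ means that $C$ is an $\mathbb F_q$-linear subspace. $\mathbb F_q^{t\times n}$ denotes the set of $t\times n$ matrices over $\mathbb F_q$. The $t$-distance $d^{(t)}(\mathbf v,\mathbf u)$ between $\mathbf v,\mathbf u\in\mathbb F_q^{t\times n}$ is the number of columns in which they differ. For a nonempty $C\subseteq \mathbb F_q^n$, $C^t\subseteq \mathbb F_q^{t\times n}$ is the set of $t\times n$ matrices all of whose rows belong to $C$, and the $t$-th covering radius of $C$ is \[ R_t(C):=\max_{\mathbf u\in \mathbb F_q^{t\times n}}\ \min_{\mathbf c\in C^t} d^{(t)}(\mathbf c,\mathbf u). \] *)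

theory Defs
  imports
    Complex_Main
    "HOL-Library.Cardinality"
    "Jordan_Normal_Form.VS_Connect"
begin

(* The alphabet F_q is a type 'a of class {field, finite} with CARD('a) = q; the word space
   F_q^n is carrier_vec n and the matrix space F_q^(t x n) is carrier_mat t n. *)

(* The convention 0 * log_Q 0 = 0 holds automatically, because of the factor 0. *)
definition entropy :: "nat \<Rightarrow> real \<Rightarrow> real" where
  "entropy Q x =
     x * log (real Q) (real Q - 1) - x * log (real Q) x - (1 - x) * log (real Q) (1 - x)"

definition linear_code :: "nat \<Rightarrow> 'a::field vec set \<Rightarrow> bool" where
  "linear_code n C \<longleftrightarrow> VectorSpace.subspace class_ring C (module_vec TYPE('a) n)"

(* Dimension of C as a vector space in its own right, with the operations inherited from F_q^n. *)
definition code_dim :: "nat \<Rightarrow> 'a::field vec set \<Rightarrow> nat" where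
  "code_dim n C = vectorspace.dim class_ring ((module_vec TYPE('a) n)\<lparr>carrier := C\<rparr>)"

(* Only meant for matrices of equal dimensions. *)
definition t_distance :: "'a mat \<Rightarrow> 'a mat \<Rightarrow> nat" where
  "t_distance A B = card {j. j < dim_col A \<and> col A j \<noteq> col B j}"

definition code_power :: "nat \<Rightarrow> nat \<Rightarrow> 'a vec set \<Rightarrow> 'a mat set" where
  "code_power t n C = {A \<in> carrier_mat t n. \<forall>i<t. row A i \<in> C}"

(* For a finite alphabet and a nonempty C contained in carrier_vec n, both sets below are finite
   and nonempty, so that Max and Min are genuine. *)
definition covering_radius :: "nat \<Rightarrow> nat \<Rightarrow> 'a vec set \<Rightarrow> nat" where
  "covering_radius t n C =
     Max ((\<lambda>U. Min ((\<lambda>A. t_distance A U) ` code_power t n C)) ` carrier_mat t n)"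

end

theory Submission
  imports Defs "HOL-Combinatorics.Multiset_Permutations"
begin

text \<open>
  Put \<open>Q = q\<^sup>t\<close> and let \<open>T\<close> be the set of \<open>t \<times> n\<close> matrices in which each of the \<open>Q - 1\<close> nonzero columns occurs
  exactly \<open>a = \<lfloor>\<theta> n / (Q - 1)\<rfloor>\<close> times; its elements have weight at most \<open>\<theta> n\<close>, and up to a factor polynomial
  in \<open>n\<close> it is as large as the whole ball. For a random generator matrix \<open>G\<close> with \<open>k \<approx> n (1 - H\<^sub>Q(\<theta>))\<close> rows,
  the second moment of the number of representations \<open>M G + X\<close> (with \<open>X \<in> T\<close>) is governed by the pairs in \<open>T\<close>
  that differ by columns from the column space \<open>W\<close> of a difference \<open>M - M'\<close>. Since \<open>T\<close> is a single composition
  class, there are at most \<open>|W|\<close> to the power \<open>n H\<^sub>Q\<close> such partners of each element, which exactly balances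
  the small number of matrices \<open>M\<close> with column space \<open>W\<close>; so by Cauchy-Schwarz some \<open>G\<close> covers a
  \<open>1 / poly(n)\<close> fraction of all matrices. Each addition of \<open>t\<close> further generators can square the uncovered fraction,
  and \<open>O(log n)\<close> such steps leave nothing uncovered.
\<close>

subsection \<open>Factorials and the entropy of a composition\<close>

text \<open>After division by \<open>fact n\<close>, the left side is a single term of the
  exponential series of \<open>exp n\<close>.\<close>

lemma power_self_le_exp_fact: "real n ^ n \<le> exp (real n) * fact n"
proof -
  have "(\<lambda>k. real n ^ k /\<^sub>R fact k) sums exp (real n)"
    by (rule exp_converges)
  hence "(\<Sum>k\<in>{n}. real n ^ k /\<^sub>R fact k) \<le> exp (real n)"
    by (metis (no_types, lifting) finite.emptyI finite_insert inverse_nonnegative_iff_nonnegative fact_ge_zero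
        of_nat_0_le_iff scaleR_nonneg_nonneg sum_le_suminf sums_summable sums_unique zero_le_power)
  thus ?thesis by (simp add: field_simps)
qed

text \<open>A Stirling-type upper bound. The induction step amounts to
  \<open>exp 1 \<le> (1 + 1 / a) ^ (a + 1)\<close>, which comes from \<open>ln y \<le> y - 1\<close>
  at \<open>y = a / (a + 1)\<close>.\<close>

lemma fact_exp_le: 
  assumes "a \<ge> 1"
  shows "fact a * exp (real a) \<le> exp 1 * real a * real a ^ a"
  using assms
proof (induction a rule: nat_induct_at_least)
  case (Suc a)
  have "1 / (real a + 1) \<le> ln (1 + 1 / real a)"
  proof -
    have "ln (real a / (real a + 1)) \<le> real a / (real a + 1) - 1"
      using Suc.hyps by (intro ln_le_minus_one) auto
    also have "\<dots> = - 1 / (real a + 1)" by (simp add: field_simps)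
    also have "ln (real a / (real a + 1)) = - ln (1 + 1 / real a)"
      using Suc.hyps by (simp add: ln_div add_divide_distrib[symmetric] field_simps)
    finally show ?thesis by simp
  qed
  hence "1 \<le> real (Suc a) * ln (1 + 1 / real a)"
    by (simp add: field_simps)
  hence "exp 1 \<le> exp (ln ((1 + 1 / real a) ^ Suc a))"
    using Suc.hyps by (subst ln_realpow) (auto simp: add_pos_nonneg)
  also have "\<dots> = (1 + 1 / real a) ^ Suc a"
    by (intro exp_ln zero_less_power) (auto simp: add_pos_nonneg)
  finally have "exp 1 * real a ^ Suc a \<le> ((1 + 1 / real a) * real a) ^ Suc a"
    unfolding power_mult_distrib by (intro mult_right_mono) auto
  also have "(1 + 1 / real a) * real a = real (Suc a)"
    using Suc.hyps by (simp add: field_simps)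
  finally have *: "exp 1 * real a ^ Suc a \<le> real (Suc a) ^ Suc a" .
  have "fact (Suc a) * exp (real (Suc a)) = real (Suc a) * exp 1 * (fact a * exp (real a))"
    by (simp add: exp_add algebra_simps)
  also have "\<dots> \<le> real (Suc a) * exp 1 * (exp 1 * real a * real a ^ a)"
    by (intro mult_left_mono Suc.IH) auto
  also have "\<dots> = real (Suc a) * exp 1 * (exp 1 * real a ^ Suc a)" by simp
  also have "\<dots> \<le> real (Suc a) * exp 1 * real (Suc a) ^ Suc a"
    by (intro mult_left_mono *) auto
  finally show ?case by (simp add: mult_ac)
qed simp

text \<open>Lower bound for the multinomial coefficient with \<open>m\<close> parts \<open>a\<close>
  and one part \<open>b\<close>. The numerator is estimated by \<open>power_self_le_exp_fact\<close>
  and each of the \<open>m + 1\<close> factorials below by \<open>fact_exp_le\<close>; the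
  exponentials cancel because the parts sum to \<open>n\<close>, and a polynomial factor is
  lost.\<close>

lemma mult_fact_power_le:
  fixes a b m :: nat
  assumes "a \<ge> 1" "b \<ge> 1"
  shows "real (m * a + b) ^ (m * a + b) \<le>
    fact (m * a + b) / (fact a ^ m * fact b) * ((exp 1 * real (m * a + b)) ^ (m + 1)
      * (real a ^ (m * a) * real b ^ b))"
proof (cases "m = 0")
  case True
  have "real b ^ b * 1 \<le> real b ^ b * (exp 1 * real b)"
    using assms mult_mono[of 1 "exp 1 :: real" 1 "real b"] by (intro mult_left_mono) auto
  thus ?thesis using True assms by (simp add: mult_ac)
next
  case False
  define n where "n = m * a + b"
  have an: "a \<le> n" and bn: "b \<le> n" using False by (auto simp: n_def trans_le_add1)
  have "(fact a * exp (real a)) ^ m * (fact b * exp (real b)) \<le>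
     (exp 1 * real a * real a ^ a) ^ m * (exp 1 * real b * real b ^ b)"
    using assms by (intro mult_mono power_mono fact_exp_le) auto
  also have "\<dots> \<le> (exp 1 * real n * real a ^ a) ^ m * (exp 1 * real n * real b ^ b)"
    using an bn by (intro mult_mono power_mono) auto
  also have "\<dots> = (exp 1 * real n) ^ (m + 1) * (real a ^ (m * a) * real b ^ b)"
    by (simp add: power_mult_distrib mult_ac power_mult flip: power_mult)
  finally have "exp (real n) * (fact a ^ m * fact b) \<le>
      (exp 1 * real n) ^ (m + 1) * (real a ^ (m * a) * real b ^ b)"
    by (simp add: n_def exp_add power_mult_distrib mult_ac flip: exp_of_nat_mult)
  hence "fact n / (fact a ^ m * fact b) * (exp (real n) * (fact a ^ m * fact b)) \<le>
    fact n / (fact a ^ m * fact b) * ((exp 1 * real n) ^ (m + 1) * (real a ^ (m * a) * real b ^ b))"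
    by (intro mult_left_mono) auto
  thus ?thesis using power_self_le_exp_fact[of n] by (simp add: n_def mult_ac)
qed

text \<open>For a matrix of length \<open>n\<close> in which every nonzero column occurs \<open>p n\<close> times and the zero column
  \<open>\<beta> n\<close> times, and for a column space \<open>W\<close> with \<open>w\<close> elements, \<open>exp (n * fibre_rate Q p \<beta> w)\<close> bounds the
  number of matrices of the same composition that agree with it modulo \<open>W\<close>: it is the conditional entropy
  (in nats) of a random column given its class modulo \<open>W\<close>.\<close>

definition fibre_rate :: "real \<Rightarrow> real \<Rightarrow> real \<Rightarrow> real \<Rightarrow> real" where
  "fibre_rate Q p \<beta> w = (Q - w) * p * ln (w * p) + (\<beta> + (w - 1) * p) * ln (\<beta> + (w - 1) * p)
     - \<beta> * ln \<beta> - (Q - 1) * p * ln p"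

text \<open>The rate is convex in \<open>ln w\<close> and vanishes at \<open>w = 1\<close>.\<close>

lemma fibre_rate_le:
  assumes "p > 0" "\<beta> > 0" "1 \<le> w" "w \<le> Q" "1 < Q"
  shows "fibre_rate Q p \<beta> w * ln Q \<le> ln w * fibre_rate Q p \<beta> Q"
proof -
  \<comment> \<open>\<open>G w\<close> is the derivative of the rate with respect to
    \<open>ln w\<close>, so its monotonicity is the convexity claimed.\<close>
  define G where "G w = p * (Q + w * (ln (\<beta> + (w - 1) * p) - ln w - ln p))" for w
  have pos: "\<beta> + (w - 1) * p > 0" if "1 \<le> w" for w
    using that assms by (simp add: add_pos_nonneg)
  have dF: "((\<lambda>s. fibre_rate Q p \<beta> (exp s)) has_real_derivative G (exp s)) (at s)" if "0 \<le> s" for s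
  proof -
    have E: "\<beta> + (exp s - 1) * p > 0" using pos[of "exp s"] that by simp
    have "((\<lambda>s. (Q - exp s) * p * (s + ln p) + (\<beta> + (exp s - 1) * p) * ln (\<beta> + (exp s - 1) * p)
       - \<beta> * ln \<beta> - (Q - 1) * p * ln p) has_real_derivative
       (- exp s * p * (s + ln p) + (Q - exp s) * p + (exp s * p * ln (\<beta> + (exp s - 1) * p)
         + exp s * p))) (at s)"
      using E by (auto intro!: derivative_eq_intros)
    moreover have "(- exp s * p * (s + ln p) + (Q - exp s) * p + (exp s * p * ln (\<beta> + (exp s - 1) * p)
         + exp s * p)) = G (exp s)"
      unfolding G_def using E assms by (simp add: ln_div ln_mult algebra_simps)
    moreover have "ln (exp s * p) = s + ln p" for s using assms by (simp add: ln_mult)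
    ultimately show ?thesis unfolding fibre_rate_def by simp
  qed
  have dG: "(G has_real_derivative
      p * (ln (\<beta> + (w - 1) * p) - ln w - ln p + (w * p) / (\<beta> + (w - 1) * p) - 1)) (at w)"
    if "1 \<le> w" for w
  proof -
    have "(G has_real_derivative p * ((ln (\<beta> + (w - 1) * p) - ln w - ln p) +
        w * (p / (\<beta> + (w - 1) * p) - 1 / w))) (at w)"
      unfolding G_def using pos[OF that] that by (auto intro!: derivative_eq_intros)
    thus ?thesis using that by (simp add: right_diff_distrib add_diff_eq)
  qed
  have G_mono: "G x \<le> G y" if "1 \<le> x" "x \<le> y" for x y
  proof (rule DERIV_nonneg_imp_nondecreasing[OF that(2)])
    fix w assume w: "x \<le> w" "w \<le> y"
    \<comment> \<open>With this \<open>z\<close> the derivative of \<open>G\<close> is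
      \<open>p * (z - 1 - ln z)\<close>.\<close>
    define z where "z = (w * p) / (\<beta> + (w - 1) * p)"
    have z: "z > 0" using pos[of w] w that assms by (auto simp: z_def)
    have "ln z = ln w + ln p - ln (\<beta> + (w - 1) * p)"
      unfolding z_def using pos[of w] w that assms by (simp add: ln_div ln_mult)
    moreover have "ln z \<le> z - 1" using z by (rule ln_le_minus_one)
    ultimately have "0 \<le> p * (ln (\<beta> + (w - 1) * p) - ln w - ln p + z - 1)"
      using assms by simp
    thus "\<exists>y. DERIV G w :> y \<and> 0 \<le> y"
      using dG[of w] w that unfolding z_def by auto
  qed
  define g where "g s = fibre_rate Q p \<beta> (exp s)" for s
  define s L where "s = ln w" and "L = ln Q"
  have sL: "0 \<le> s" "s \<le> L" using assms by (auto simp: s_def L_def)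
  have g0: "g 0 = 0" by (simp add: g_def fibre_rate_def)
  \<comment> \<open>A convex function vanishing at 0 lies below its chord: by the mean value theorem
    the average slope on \<open>[0, s]\<close> is at most that on \<open>[s, L]\<close>.\<close>
  have "g s * L \<le> s * g L"
  proof (cases "s = 0 \<or> s = L")
    case False
    hence "0 < s" "s < L" using sL by auto
    from MVT2[OF this(1), of g "\<lambda>s. G (exp s)"] dF obtain z1 where
      z1: "0 < z1" "z1 < s" "g s - g 0 = (s - 0) * G (exp z1)" unfolding g_def by auto
    from MVT2[OF \<open>s < L\<close>, of g "\<lambda>s. G (exp s)"] dF \<open>0 < s\<close> obtain z2 where
      z2: "s < z2" "z2 < L" "g L - g s = (L - s) * G (exp z2)" unfolding g_def by auto
    have "G (exp z1) \<le> G (exp z2)" using z1 z2 by (intro G_mono) auto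
    hence "s * (L - s) * G (exp z1) \<le> s * (L - s) * G (exp z2)"
      using \<open>0 < s\<close> \<open>s < L\<close> by (intro mult_left_mono) auto
    hence "(L - s) * g s \<le> s * (g L - g s)"
      using z1(3) z2(3) g0 by (simp add: mult_ac)
    thus ?thesis by (simp add: algebra_simps)
  qed (auto simp: g0)
  thus ?thesis using assms by (simp add: g_def s_def L_def)
qed

text \<open>At \<open>w = Q\<close> the first term has a factor 0 and the second is
  \<open>1 * ln 1\<close>. What remains is the Shannon entropy in nats of a column that is zero with
  probability \<beta> and takes each of the \<open>Q - 1\<close> other values with probability
  \<open>p\<close>.\<close>

lemma fibre_rate_top:
  "\<beta> + (Q - 1) * p = 1 \<Longrightarrow> fibre_rate Q p \<beta> Q = - \<beta> * ln \<beta> - (Q - 1) * p * ln p"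
  by (simp add: fibre_rate_def)

text \<open>Gibbs' inequality against the uniform distribution: apply
  \<open>ln y \<le> y - 1\<close> to the ratio of \<open>1 / Q\<close> to each probability; the
  weighted right-hand sides sum to 0.\<close>

lemma fibre_rate_top_le_ln:
  assumes "p > 0" "\<beta> > 0" "1 < Q" "\<beta> + (Q - 1) * p = 1"
  shows "fibre_rate Q p \<beta> Q \<le> ln Q"
proof -
  have "\<beta> * ln (1 / (Q * \<beta>)) + (Q - 1) * p * ln (1 / (Q * p))
      \<le> \<beta> * (1 / (Q * \<beta>) - 1) + (Q - 1) * p * (1 / (Q * p) - 1)"
    using assms by (intro add_mono mult_left_mono ln_le_minus_one) auto
  also have "\<beta> * (1 / (Q * \<beta>) - 1) = 1 / Q - \<beta>"
    using assms by (simp add: field_simps)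
  also have "(Q - 1) * p * (1 / (Q * p) - 1) = (Q - 1) / Q - (Q - 1) * p"
    using assms by (simp add: field_simps)
  also have "1 / Q - \<beta> + ((Q - 1) / Q - (Q - 1) * p) = (1 / Q + (Q - 1) / Q) - (\<beta> + (Q - 1) * p)"
    by simp
  also have "\<dots> = 0" using assms(3) unfolding assms(4) by (simp add: field_simps)
  also have "ln (1 / (Q * \<beta>)) = - ln Q - ln \<beta>"
    using assms by (simp add: ln_div ln_mult)
  also have "ln (1 / (Q * p)) = - ln Q - ln p"
    using assms by (simp add: ln_div ln_mult)
  finally have "- \<beta> * ln \<beta> - (Q - 1) * p * ln p \<le> ln Q * (\<beta> + (Q - 1) * p)"
    by (simp only: algebra_simps)
  thus ?thesis using fibre_rate_top[OF assms(4)] assms(4) by simp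
qed

section \<open>Image size and collisions\<close>

text \<open>Cauchy-Schwarz for the fibre sizes of \<open>f\<close>: they sum to
  \<open>card A\<close>, and their squares sum to the number of colliding pairs.\<close>

lemma card_power2_le_image_mult_collisions:
  assumes "finite A"
  shows "(card A)\<^sup>2 \<le> card (f ` A) * card {(x, y) \<in> A \<times> A. f x = f y}"
proof -
  define c where "c u = card {x \<in> A. f x = u}" for u
  have A: "card A = (\<Sum>u\<in>f ` A. c u)"
    using sum.image_gen[OF assms, of "\<lambda>_. 1::nat" f] by (simp add: c_def)
  have "{(x, y) \<in> A \<times> A. f x = f y} = (SIGMA x:A. {y \<in> A. f y = f x})" by auto
  hence "card {(x, y) \<in> A \<times> A. f x = f y} = (\<Sum>x\<in>A. c (f x))"
    using assms by (simp add: c_def)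
  also have "\<dots> = (\<Sum>u\<in>f ` A. \<Sum>x\<in>{x \<in> A. f x = u}. c (f x))"
    by (rule sum.image_gen[OF assms])
  also have "\<dots> = (\<Sum>u\<in>f ` A. c u * c u)"
    by (intro sum.cong) (auto simp: c_def)
  finally have B: "card {(x, y) \<in> A \<times> A. f x = f y} = (\<Sum>u\<in>f ` A. c u * c u)" .
  \<comment> \<open>Expanding the squared differences over all pairs of values yields Cauchy-Schwarz
    against the constant function 1.\<close>
  have "0 \<le> (\<Sum>u\<in>f ` A. \<Sum>v\<in>f ` A. (real (c u) - real (c v))\<^sup>2)"
    by (intro sum_nonneg) auto
  also have "\<dots> = 2 * (real (card (f ` A)) * (\<Sum>u\<in>f ` A. real (c u) * real (c u)))
      - 2 * ((\<Sum>u\<in>f ` A. real (c u)) * (\<Sum>u\<in>f ` A. real (c u)))"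
  proof -
    have *: "(real (c u) - real (c v))\<^sup>2 = real (c u) * real (c u) + real (c v) * real (c v)
       - 2 * (real (c u) * real (c v))" for u v
      by (simp add: power2_eq_square algebra_simps)
    show ?thesis
      unfolding * sum.distrib sum_subtractf sum_product sum_distrib_left[symmetric]
      by (simp add: sum_distrib_left algebra_simps flip: sum.distrib)
  qed
  finally have "(\<Sum>u\<in>f ` A. real (c u))\<^sup>2 \<le> real (card (f ` A)) * (\<Sum>u\<in>f ` A. real (c u) * real (c u))"
    by (simp add: power2_eq_square)
  hence "real ((card A)\<^sup>2) \<le> real (card (f ` A) * card {(x, y) \<in> A \<times> A. f x = f y})"
    unfolding A B by simp
  thus ?thesis by (simp only: of_nat_le_iff)
qed

subsection \<open>Counting matrices by their columns\<close>

lemma bij_betw_vec_PiE: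
  "bij_betw (\<lambda>f. vec n f) (PiE {..<n} (\<lambda>_. UNIV)) (carrier_vec n)"
  by (rule bij_betw_byWitness[of _ "\<lambda>v. restrict (\<lambda>i. v $ i) {..<n}"])
     (auto simp: PiE_def extensional_def fun_eq_iff)

lemma finite_carrier_vec [simp]: "finite (carrier_vec n :: 'a::finite vec set)"
  using bij_betw_finite[OF bij_betw_vec_PiE[of n, where 'a='a]] by (simp add: finite_PiE)

lemma card_carrier_vec [simp]: "card (carrier_vec n :: 'a::finite vec set) = CARD('a) ^ n"
  using bij_betw_same_card[OF bij_betw_vec_PiE[of n, where 'a='a]] by (simp add: card_PiE)

lemma bij_betw_mat_of_cols_PiE:
  "bij_betw (\<lambda>f. mat_of_cols k (map f [0..<n])) (PiE {..<n} (\<lambda>_. carrier_vec k)) (carrier_mat k n)"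
proof (rule bij_betw_byWitness[of _ "\<lambda>A. restrict (col A) {..<n}"])
  show "\<forall>A\<in>carrier_mat k n. mat_of_cols k (map (restrict (col A) {..<n}) [0..<n]) = A"
    by (auto intro!: eq_matI simp: mat_of_cols_index)
qed (auto simp: PiE_def extensional_def fun_eq_iff Pi_iff)

text \<open>Choosing a matrix means choosing its columns independently, so this is the distributive
  law for a product of sums.\<close>

lemma sum_prod_cols:
  fixes f :: "nat \<Rightarrow> 'a::finite vec \<Rightarrow> 'b::comm_semiring_1"
  shows "(\<Sum>A\<in>carrier_mat k n. \<Prod>j<n. f j (col A j)) = (\<Prod>j<n. \<Sum>v\<in>carrier_vec k. f j v)"
proof -
  have "(\<Prod>j<n. \<Sum>v\<in>carrier_vec k. f j v) =
      (\<Sum>g\<in>PiE {..<n} (\<lambda>_. carrier_vec k). \<Prod>j<n. f j (g j))"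
    by (rule prod_sum_PiE) auto
  also have "\<dots> = (\<Sum>g\<in>PiE {..<n} (\<lambda>_. carrier_vec k). \<Prod>j<n. f j (col (mat_of_cols k (map g [0..<n])) j))"
    by (intro sum.cong prod.cong refl) (auto simp: PiE_iff)
  also have "\<dots> = (\<Sum>A\<in>carrier_mat k n. \<Prod>j<n. f j (col A j))"
    by (rule sum.reindex_bij_betw[OF bij_betw_mat_of_cols_PiE])
  finally show ?thesis ..
qed

lemma finite_carrier_mat [simp]: "finite (carrier_mat k n :: 'a::finite mat set)"
  using bij_betw_finite[OF bij_betw_mat_of_cols_PiE[of k n, where 'a='a]] by (simp add: finite_PiE)

text \<open>The indicator of the condition is a product of column indicators, to which
  \<open>sum_prod_cols\<close> applies.\<close>

lemma card_mats_cols_in: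
  fixes W :: "'a::finite vec set"
  assumes "W \<subseteq> carrier_vec k"
  shows "card {A \<in> carrier_mat k n. \<forall>j<n. col A j \<in> W} = card W ^ n"
proof -
  have "card {A \<in> carrier_mat k n. \<forall>j<n. col A j \<in> W} =
      (\<Sum>A\<in>carrier_mat k n. if \<forall>j<n. col A j \<in> W then 1 else 0)"
    by (subst sum.inter_filter[symmetric]) auto
  also have "\<dots> = (\<Sum>A\<in>carrier_mat k n. \<Prod>j<n. if col A j \<in> W then 1 else 0)"
  proof (intro sum.cong refl)
    fix A :: "'a mat"
    show "(if \<forall>j<n. col A j \<in> W then 1 else 0 :: nat) = (\<Prod>j<n. if col A j \<in> W then 1 else 0)"
      by (cases "\<forall>j<n. col A j \<in> W") (auto intro!: prod_zero[symmetric])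
  qed
  also have "\<dots> = (\<Prod>j<n. \<Sum>v\<in>carrier_vec k. if v \<in> W then 1 else 0)"
    by (rule sum_prod_cols)
  also have "(\<Sum>v\<in>carrier_vec k. if v \<in> W then 1 else 0) = card W"
    using assms by (subst sum.inter_filter[symmetric]) (auto simp: Int_absorb1 Collect_conj_eq[symmetric] intro!: arg_cong[of _ _ card])
  also have "(\<Prod>j<n. card W) = card W ^ n" by simp
  finally show ?thesis .
qed

lemma card_carrier_mat [simp]: "card (carrier_mat k n :: 'a::finite mat set) = CARD('a) ^ (k * n)"
  using card_mats_cols_in[of "carrier_vec k :: 'a vec set" k n]
  by (simp add: power_mult cong: conj_cong)

section \<open>Column spaces of matrices\<close>

text \<open>The column space of \<open>M\<close> when \<open>k\<close> is its number of
  columns.\<close>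

definition mat_range :: "nat \<Rightarrow> 'a::semiring_0 mat \<Rightarrow> 'a vec set" where
  "mat_range k M = (\<lambda>v. M *\<^sub>v v) ` carrier_vec k"

text \<open>Every nonempty fibre of multiplication by \<open>M\<close> is a coset of the kernel, so
  all of them have the same size.\<close>

lemma sum_mult_mat_vec:
  fixes M :: "'a::{field,finite} mat" and \<phi> :: "'a vec \<Rightarrow> real"
  assumes M: "M \<in> carrier_mat t k"
  shows "(\<Sum>v\<in>carrier_vec k. \<phi> (M *\<^sub>v v)) =
    CARD('a) ^ k / card (mat_range k M) * (\<Sum>y\<in>mat_range k M. \<phi> y)"
proof -
  define Ker where "Ker = {v \<in> carrier_vec k. M *\<^sub>v v = 0\<^sub>v t}"
  have fib: "card {v \<in> carrier_vec k. M *\<^sub>v v = y} = card Ker" if y: "y \<in> mat_range k M" for y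
  proof -
    obtain x where x: "x \<in> carrier_vec k" "y = M *\<^sub>v x"
      using y by (auto simp: mat_range_def)
    have "bij_betw (\<lambda>v. v - x) {v \<in> carrier_vec k. M *\<^sub>v v = y} Ker"
      using x M by (intro bij_betw_byWitness[of _ "\<lambda>v. v + x"])
        (auto simp: Ker_def mult_minus_distrib_mat_vec mult_add_distrib_mat_vec)
    thus ?thesis by (rule bij_betw_same_card)
  qed
  have *: "(\<Sum>v\<in>carrier_vec k. \<psi> (M *\<^sub>v v)) = real (card Ker) * (\<Sum>y\<in>mat_range k M. \<psi> y)"
    for \<psi> :: "'a vec \<Rightarrow> real"
    unfolding sum.image_gen[of "carrier_vec k" "\<lambda>v. \<psi> (M *\<^sub>v v)" "\<lambda>v. M *\<^sub>v v", OF finite_carrier_vec]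
    by (simp add: mat_range_def[symmetric] sum_distrib_left fib)
  have "0\<^sub>v k \<in> (carrier_vec k :: 'a vec set)" by simp
  hence "mat_range k M \<noteq> {}" "finite (mat_range k M)"
    unfolding mat_range_def by (blast, simp)
  hence "card (mat_range k M) \<noteq> 0" by simp
  \<comment> \<open>The constant function 1 yields the kernel size:
    \<open>CARD('a) ^ k = card Ker * card (mat_range k M)\<close>.\<close>
  thus ?thesis using *[of "\<lambda>_. 1"] *[of \<phi>] by (simp add: field_simps)
qed

text \<open>Only \<open>y = - x\<close> makes the sum zero, and it lies in the column space exactly
  when \<open>x\<close> does.\<close>

lemma sum_coset_mat_range:
  fixes M :: "'a::{field,finite} mat" and p \<beta> :: real
  assumes M: "M \<in> carrier_mat t k" and x: "x \<in> carrier_vec t"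
  shows "(\<Sum>y\<in>mat_range k M. if x + y = 0\<^sub>v t then \<beta> else p) =
    (if x \<in> mat_range k M then \<beta> + (real (card (mat_range k M)) - 1) * p else card (mat_range k M) * p)"
proof -
  have fin: "finite (mat_range k M)" by (simp add: mat_range_def)
  have car: "y \<in> carrier_vec t" if "y \<in> mat_range k M" for y
    using that M by (auto simp: mat_range_def)
  have neg: "- y \<in> mat_range k M" if y: "y \<in> mat_range k M" for y
  proof -
    obtain v where "v \<in> carrier_vec k" "y = M *\<^sub>v v" using y by (auto simp: mat_range_def)
    hence "- y = M *\<^sub>v (- v)" "- v \<in> carrier_vec k" using M by auto
    thus ?thesis by (auto simp: mat_range_def)
  qed
  have eq: "x + y = 0\<^sub>v t \<longleftrightarrow> y = - x" if "y \<in> mat_range k M" for y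
    using car[OF that] x by (auto simp: vec_eq_iff eq_neg_iff_add_eq_0 add.commute)
  have mem: "- x \<in> mat_range k M \<longleftrightarrow> x \<in> mat_range k M"
    using neg[of x] neg[of "-x"] x by auto
  have "(\<Sum>y\<in>mat_range k M. if x + y = 0\<^sub>v t then \<beta> else p) =
      (\<Sum>y\<in>mat_range k M. p + (if y = - x then \<beta> - p else 0))"
    by (intro sum.cong) (auto simp: eq)
  also have "\<dots> = card (mat_range k M) * p + (if x \<in> mat_range k M then \<beta> - p else 0)"
    using fin by (simp add: sum.distrib mem)
  also have "\<dots> = (if x \<in> mat_range k M then \<beta> + (real (card (mat_range k M)) - 1) * p
      else card (mat_range k M) * p)"
  proof (cases "x \<in> mat_range k M")
    case True
    then obtain m where "card (mat_range k M) = Suc m"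
      using fin by (metis card_Suc_Diff1)
    thus ?thesis using True by (simp add: algebra_simps)
  qed simp
  finally show ?thesis .
qed

section \<open>Composition classes\<close>

definition comp_mset :: "nat \<Rightarrow> nat \<Rightarrow> nat \<Rightarrow> 'a::{zero,finite} vec multiset" where
  "comp_mset t a b = replicate_mset b (0\<^sub>v t) + (\<Sum>v\<in>carrier_vec t - {0\<^sub>v t}. replicate_mset a v)"

text \<open>A type class in the sense of information theory: fixing the column multiset makes every
  product of column weights constant and the size a multinomial coefficient.\<close>

definition comp_class :: "nat \<Rightarrow> nat \<Rightarrow> nat \<Rightarrow> nat \<Rightarrow> 'a::{zero,finite} mat set" where
  "comp_class t n a b = {X \<in> carrier_mat t n. mset (cols X) = comp_mset t a b}"

lemma prod_comp_mset:
  "(\<Prod>v\<in>#comp_mset t a b. f v) = f (0\<^sub>v t) ^ b * (\<Prod>v\<in>carrier_vec t - {0\<^sub>v t}. f v ^ a)"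
proof -
  have "(\<Prod>v\<in>#(\<Sum>v\<in>S. replicate_mset a v). f v) = (\<Prod>v\<in>S. f v ^ a)" if "finite S" for S
    using that by induction auto
  thus ?thesis by (simp add: comp_mset_def)
qed

lemma prod_cols_eq:
  assumes "X \<in> carrier_mat t n"
  shows "(\<Prod>j<n. f (col X j)) = (\<Prod>v\<in>#mset (cols X). f v)"
  using assms unfolding cols_def
  by (simp add: prod_mset_prod_list prod.list_conv_set_nth atLeast0LessThan comp_def
      flip: mset_map)

lemma comp_mset_count:
  "count (comp_mset t a b) v = (if v = 0\<^sub>v t then b else if v \<in> carrier_vec t then a else 0)"
proof -
  have "count (\<Sum>v\<in>S. replicate_mset a v) v = (if v \<in> S then a else 0)" if "finite S" for S
    using that by induction auto
  thus ?thesis by (simp add: comp_mset_def)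
qed

lemma size_comp_mset:
  "size (comp_mset t a b :: 'a::{zero,finite} vec multiset) = (CARD('a) ^ t - 1) * a + b"
proof -
  have "size (\<Sum>v\<in>S. replicate_mset a v) = card S * a" if "finite S" for S :: "'a vec set"
    using that by induction auto
  thus ?thesis by (simp add: comp_mset_def)
qed

text \<open>The multiplicity \<open>b\<close> of the zero vector counts the zero columns. Hence
  every element has weight \<open>n - b\<close>, which later bounds the covering radius.\<close>

lemma card_nonzero_cols:
  assumes "X \<in> comp_class t n a b"
  shows "card {j. j < n \<and> col X j \<noteq> 0\<^sub>v t} + b = n"
proof -
  have X: "X \<in> carrier_mat t n" "mset (cols X) = comp_mset t a b"
    using assms by (auto simp: comp_class_def)
  have "b = count (mset (cols X)) (0\<^sub>v t)" by (simp add: X comp_mset_count)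
  also have "\<dots> = card {j. j < n \<and> col X j = 0\<^sub>v t}"
    using X(1) by (simp add: count_mset count_list_eq_length_filter length_filter_conv_card eq_commute
       cong: conj_cong)
  finally have "card {j. j < n \<and> col X j \<noteq> 0\<^sub>v t} + b =
      card ({j. j < n \<and> col X j \<noteq> 0\<^sub>v t} \<union> {j. j < n \<and> col X j = 0\<^sub>v t})"
    by (subst card_Un_disjoint) auto
  also have "{j. j < n \<and> col X j \<noteq> 0\<^sub>v t} \<union> {j. j < n \<and> col X j = 0\<^sub>v t} = {..<n}" by auto
  finally show ?thesis by simp
qed

text \<open>Taking columns is a bijection onto the orderings of \<open>comp_mset t a b\<close>,
  which a multinomial coefficient counts.\<close>

lemma card_comp_class:
  assumes n: "n = (CARD('a::{zero,finite}) ^ t - 1) * a + b" 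
  shows "real (card (comp_class t n a b :: 'a mat set)) =
    fact n / (fact a ^ (CARD('a) ^ t - 1) * fact b)"
proof -
  let ?A = "comp_mset t a b :: 'a vec multiset"
  have sub: "set_mset ?A \<subseteq> carrier_vec t"
    by (auto simp: set_mset_def comp_mset_count split: if_splits)
  have "bij_betw cols (comp_class t n a b) (permutations_of_multiset ?A)"
  proof (rule bij_betw_byWitness[of _ "mat_of_cols t"])
    show "\<forall>X\<in>comp_class t n a b. mat_of_cols t (cols X) = X"
      by (auto simp: comp_class_def)
    have *: "set xs \<subseteq> carrier_vec t" "length xs = n" if "mset xs = ?A" for xs
    proof -
      show "set xs \<subseteq> carrier_vec t" using sub by (simp flip: that)
      show "length xs = n" using n unfolding size_mset[symmetric] that by (simp add: size_comp_mset)
    qed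
    show "\<forall>xs\<in>permutations_of_multiset ?A. cols (mat_of_cols t xs) = xs"
      using * by (auto simp: permutations_of_multiset_def)
    show "mat_of_cols t ` permutations_of_multiset ?A \<subseteq> comp_class t n a b"
      using * by (auto simp: permutations_of_multiset_def comp_class_def)
  qed (auto simp: comp_class_def permutations_of_multiset_def)
  hence "card (comp_class t n a b :: 'a mat set) = card (permutations_of_multiset ?A)"
    by (rule bij_betw_same_card)
  \<comment> \<open>Columns absent from the multiset contribute \<open>fact 0 = 1\<close>, so
    \<open>a = 0\<close> or \<open>b = 0\<close> needs no separate case.\<close>
  moreover have "(\<Prod>x\<in>set_mset ?A. fact (count ?A x)) = (\<Prod>x\<in>carrier_vec t. fact (count ?A x) :: nat)"
    by (intro prod.mono_neutral_left) (use sub in \<open>auto simp: not_in_iff\<close>)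
  moreover have "\<dots> = fact a ^ (CARD('a) ^ t - 1) * fact b"
    by (subst prod.remove[of _ "0\<^sub>v t"]) (auto simp: comp_mset_count)
  ultimately have "card (comp_class t n a b :: 'a mat set) * (fact a ^ (CARD('a) ^ t - 1) * fact b) = fact n"
    using card_permutations_of_multiset_aux[of ?A] n by (simp add: size_comp_mset)
  hence "real (card (comp_class t n a b :: 'a mat set)) * (fact a ^ (CARD('a) ^ t - 1) * fact b) = fact n"
    by (metis of_nat_fact of_nat_mult of_nat_power)
  thus ?thesis by (simp add: field_simps)
qed

text \<open>Weight a column by \<open>\<beta>\<close> if it is zero and by \<open>p\<close> otherwise. The product weight is constant on the
  composition class, and its sum over all \<open>X + M * G\<close> factorises over the columns.\<close>

lemma card_fibre_le:
  fixes M :: "'a::{field,finite} mat" and p \<beta> :: real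
  assumes M: "M \<in> carrier_mat t k" and X: "X \<in> comp_class t n a b" and pos: "p \<ge> 0" "\<beta> \<ge> 0"
  defines "w \<equiv> card (mat_range k M)"
  shows "real (card {G \<in> carrier_mat k n. X + M * G \<in> comp_class t n a b}) *
      (\<beta> ^ b * p ^ ((CARD('a) ^ t - 1) * a)) \<le>
    (CARD('a) ^ k / w) ^ n * ((\<beta> + (real w - 1) * p) ^ (b + (w - 1) * a) * (w * p) ^ ((CARD('a) ^ t - w) * a))"
proof -
  define \<phi> where "\<phi> v = (if v = 0\<^sub>v t then \<beta> else p)" for v :: "'a vec"
  have fin: "finite (mat_range k M)" by (simp add: mat_range_def)
  have W: "mat_range k M \<subseteq> carrier_vec t" using M by (auto simp: mat_range_def)
  have "0\<^sub>v t = M *\<^sub>v 0\<^sub>v k" using M by auto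
  hence zero: "0\<^sub>v t \<in> mat_range k M" by (auto simp: mat_range_def)
  have Xc: "X \<in> carrier_mat t n" "mset (cols X) = comp_mset t a b" using X by (auto simp: comp_class_def)
  have "real (card {G \<in> carrier_mat k n. X + M * G \<in> comp_class t n a b}) *
      (\<beta> ^ b * p ^ ((CARD('a) ^ t - 1) * a)) =
      (\<Sum>G\<in>{G \<in> carrier_mat k n. X + M * G \<in> comp_class t n a b}. \<Prod>v\<in>#comp_mset t a b. \<phi> v)"
    by (simp add: prod_comp_mset \<phi>_def power_mult mult.commute)
  also have "\<dots> = (\<Sum>G\<in>{G \<in> carrier_mat k n. X + M * G \<in> comp_class t n a b}. \<Prod>j<n. \<phi> (col (X + M * G) j))"
  proof (intro sum.cong refl)
    fix G assume "G \<in> {G \<in> carrier_mat k n. X + M * G \<in> comp_class t n a b}"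
    thus "(\<Prod>v\<in>#comp_mset t a b. \<phi> v) = (\<Prod>j<n. \<phi> (col (X + M * G) j))"
      by (subst prod_cols_eq[of _ t n]) (auto simp: comp_class_def)
  qed
  \<comment> \<open>Dropping the membership condition only adds non-negative terms and leaves a sum
    that factorises.\<close>
  also have "\<dots> \<le> (\<Sum>G\<in>carrier_mat k n. \<Prod>j<n. \<phi> (col (X + M * G) j))"
    using pos by (intro sum_mono2) (auto intro!: prod_nonneg simp: \<phi>_def)
  also have "\<dots> = (\<Sum>G\<in>carrier_mat k n. \<Prod>j<n. \<phi> (col X j + M *\<^sub>v col G j))"
    by (intro sum.cong prod.cong refl) (use Xc(1) M in \<open>auto simp: col_add mult_mat_vec_def\<close>)
  also have "\<dots> = (\<Prod>j<n. \<Sum>g\<in>carrier_vec k. \<phi> (col X j + M *\<^sub>v g))"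
    by (rule sum_prod_cols)
  also have "\<dots> = (\<Prod>j<n. CARD('a) ^ k / w * (\<Sum>y\<in>mat_range k M. \<phi> (col X j + y)))"
    unfolding w_def by (intro prod.cong refl sum_mult_mat_vec[OF M])
  also have "\<dots> = (CARD('a) ^ k / w) ^ n * (\<Prod>j<n. \<Sum>y\<in>mat_range k M. \<phi> (col X j + y))"
    by (simp only: prod.distrib prod_constant card_lessThan)
  also have "(\<Prod>j<n. \<Sum>y\<in>mat_range k M. \<phi> (col X j + y)) =
      (\<Prod>j<n. if col X j \<in> mat_range k M then \<beta> + (real w - 1) * p else w * p)"
    unfolding \<phi>_def w_def using Xc(1)
    by (intro prod.cong refl sum_coset_mat_range[OF M]) auto
  \<comment> \<open>The coset sum depends on the column of \<open>X\<close> alone, so the product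
    can be read off the composition of \<open>X\<close>.\<close>
  also have "\<dots> = (\<Prod>v\<in>#comp_mset t a b. if v \<in> mat_range k M then \<beta> + (real w - 1) * p else w * p)"
    using Xc by (subst prod_cols_eq[of _ t n]) auto
  also have "\<dots> = (\<beta> + (real w - 1) * p) ^ b *
      (\<Prod>v\<in>carrier_vec t - {0\<^sub>v t}. if v \<in> mat_range k M then (\<beta> + (real w - 1) * p) ^ a else (w * p) ^ a)"
    using zero by (simp add: prod_comp_mset if_distrib[of "\<lambda>x. x ^ a"])
  also have "(\<Prod>v\<in>carrier_vec t - {0\<^sub>v t}. if v \<in> mat_range k M then (\<beta> + (real w - 1) * p) ^ a else (w * p) ^ a)
      = ((\<beta> + (real w - 1) * p) ^ a) ^ card (mat_range k M - {0\<^sub>v t}) *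
        ((w * p) ^ a) ^ card (carrier_vec t - mat_range k M)"
  proof -
    have "(carrier_vec t - {0\<^sub>v t}) \<inter> {v. v \<in> mat_range k M} = mat_range k M - {0\<^sub>v t}"
      "(carrier_vec t - {0\<^sub>v t}) \<inter> - {v. v \<in> mat_range k M} = carrier_vec t - mat_range k M"
      using W zero by auto
    thus ?thesis by (subst prod.If_cases) auto
  qed
  also have "card (mat_range k M - {0\<^sub>v t}) = w - 1" using zero fin by (simp add: w_def)
  also have "card (carrier_vec t - mat_range k M) = CARD('a) ^ t - w"
    using W fin by (simp add: card_Diff_subset w_def)
  finally show ?thesis by (simp add: power_add mult_ac flip: power_mult)
qed

subsection \<open>The second moment for a random generator matrix\<close>

lemma mat_range_bounds:
  fixes M :: "'a::{field,finite} mat"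
  assumes "M \<in> carrier_mat t k"
  shows "mat_range k M \<subseteq> carrier_vec t" "1 \<le> card (mat_range k M)"
    "card (mat_range k M) \<le> CARD('a) ^ t"
proof -
  show sub: "mat_range k M \<subseteq> carrier_vec t" using assms by (auto simp: mat_range_def)
  have "0\<^sub>v k \<in> (carrier_vec k :: 'a vec set)" by simp
  hence "mat_range k M \<noteq> {}" "finite (mat_range k M)"
    unfolding mat_range_def by (blast, simp)
  thus "1 \<le> card (mat_range k M)" by (simp add: Suc_le_eq card_gt_0_iff)
  show "card (mat_range k M) \<le> CARD('a) ^ t"
    using card_mono[OF _ sub] by simp
qed

text \<open>Group the matrices by column space \<open>W\<close>. All columns lie in
  \<open>W\<close>, so a group has at most \<open>card W ^ k\<close> members and contributes at most
  \<open>C\<close>; the number of groups is at most the number of subsets of the column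
  alphabet.\<close>

lemma sum_mat_range_le:
  fixes \<phi> :: "nat \<Rightarrow> real" and C :: real
  assumes nonneg: "\<And>w. \<phi> w \<ge> 0"
    and le: "\<And>w. 1 \<le> w \<Longrightarrow> w \<le> CARD('a) ^ t \<Longrightarrow> real w ^ k * \<phi> w \<le> C"
  shows "(\<Sum>M\<in>(carrier_mat t k :: 'a::{field,finite} mat set). \<phi> (card (mat_range k M))) \<le> 2 ^ (CARD('a) ^ t) * C"
proof -
  let ?Z = "carrier_mat t k :: 'a mat set"
  let ?R = "mat_range k ` ?Z"
  have "0 \<le> C" using le[of 1] nonneg[of 1] by simp
  have card_R: "card ?R \<le> 2 ^ (CARD('a) ^ t)"
  proof -
    have "card ?R \<le> card (Pow (carrier_vec t :: 'a vec set))"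
      using mat_range_bounds(1) by (intro card_mono) auto
    thus ?thesis by (simp add: card_Pow)
  qed
  have "(\<Sum>M\<in>?Z. \<phi> (card (mat_range k M))) =
      (\<Sum>W\<in>?R. \<Sum>M\<in>{M\<in>?Z. mat_range k M = W}. \<phi> (card (mat_range k M)))"
    by (rule sum.image_gen) simp
  also have "\<dots> = (\<Sum>W\<in>?R. card {M\<in>?Z. mat_range k M = W} * \<phi> (card W))"
    by simp
  also have "\<dots> \<le> (\<Sum>W\<in>?R. C)"
  proof (rule sum_mono)
    fix W assume "W \<in> ?R"
    then obtain M where M: "M \<in> ?Z" "W = mat_range k M" by auto
    have sub: "{M\<in>?Z. mat_range k M = W} \<subseteq> {M\<in>?Z. \<forall>j<k. col M j \<in> W}"
    proof safe
      fix M' j assume "M' \<in> ?Z" "j < k"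
      hence "col M' j = M' *\<^sub>v unit_vec k j" by (intro eq_vecI) auto
      thus "col M' j \<in> mat_range k M'" by (auto simp: mat_range_def)
    qed
    have "card {M\<in>?Z. mat_range k M = W} \<le> card W ^ k"
      using card_mono[OF _ sub] card_mats_cols_in[of W t k] mat_range_bounds(1)[OF M(1)] M(2) by simp
    hence "card {M\<in>?Z. mat_range k M = W} * \<phi> (card W) \<le> real (card W ^ k) * \<phi> (card W)"
      by (intro mult_right_mono nonneg) (simp only: of_nat_le_iff)
    also have "\<dots> \<le> C" using le[of "card W"] mat_range_bounds[OF M(1)] M(2) by simp
    finally show "card {M\<in>?Z. mat_range k M = W} * \<phi> (card W) \<le> C" .
  qed
  also have "\<dots> = real (card ?R) * C" by simp
  also have "\<dots> \<le> 2 ^ (CARD('a) ^ t) * C"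
  proof (intro mult_right_mono \<open>0 \<le> C\<close>)
    have "real (card ?R) \<le> real (2 ^ (CARD('a) ^ t))" using card_R by (simp only: of_nat_le_iff)
    thus "real (card ?R) \<le> 2 ^ (CARD('a) ^ t)" by simp
  qed
  finally show ?thesis .
qed

text \<open>For these \<open>p\<close> and \<beta>, \<open>n\<close> times the rate is a combination
  of logarithms whose coefficients are column counts. This converts the product weights of
  \<open>card_fibre_le\<close> into the rate.\<close>

lemma exp_fibre_rate:
  fixes a b w Q n :: nat and p \<beta> :: real
  assumes "a \<ge> 1" "b \<ge> 1" "1 \<le> w" "w \<le> Q" "n = (Q - 1) * a + b"
  defines "p \<equiv> real a / real n" and "\<beta> \<equiv> real b / real n"
  shows "exp (real n * fibre_rate Q p \<beta> w) * (\<beta> ^ b * p ^ ((Q - 1) * a)) =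
    (\<beta> + (real w - 1) * p) ^ (b + (w - 1) * a) * (w * p) ^ ((Q - w) * a)"
proof -
  have n: "n > 0" using assms by simp
  have pos: "p > 0" "\<beta> > 0" unfolding p_def \<beta>_def using assms(1,2) n by auto
  have E: "\<beta> + (real w - 1) * p > 0" using pos assms(3) by (simp add: add_pos_nonneg)
  have np: "real n * p = real a" "real n * \<beta> = real b" using n by (auto simp: p_def \<beta>_def)
  have Q: "real (Q - w) = real Q - real w" "real (Q - 1) = real Q - 1" "real (w - 1) = real w - 1"
    using assms by auto
  have "real n * fibre_rate Q p \<beta> w = (real Q - real w) * (real n * p) * ln (w * p) +
      (real n * \<beta> + (real w - 1) * (real n * p)) * ln (\<beta> + (real w - 1) * p)
      - real n * \<beta> * ln \<beta> - (real Q - 1) * (real n * p) * ln p"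
    unfolding fibre_rate_def by (simp only: algebra_simps)
  also have "\<dots> = real ((Q - w) * a) * ln (w * p) + real (b + (w - 1) * a) * ln (\<beta> + (real w - 1) * p)
      - (real b * ln \<beta> + real ((Q - 1) * a) * ln p)"
    unfolding np of_nat_mult of_nat_add Q by simp
  finally have "exp (real n * fibre_rate Q p \<beta> w) =
      (w * p) ^ ((Q - w) * a) * (\<beta> + (real w - 1) * p) ^ (b + (w - 1) * a) / (\<beta> ^ b * p ^ ((Q - 1) * a))"
    using pos E assms(3) by (simp only: exp_diff exp_add exp_of_nat_mult exp_ln of_nat_0_less_iff zero_less_mult_iff) simp
  thus ?thesis using pos by (simp add: mult.commute)
qed

text \<open>\<open>card_fibre_le\<close> with \<open>p = a / n\<close> and
  \<open>\<beta> = b / n\<close> gives the rate at \<open>w\<close>, and the chord bound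
  \<open>fibre_rate_le\<close> replaces it by \<open>h * ln w\<close>. Here \<open>h\<close> is the
  entropy of the composition in base \<open>CARD('a) ^ t\<close>.\<close>

lemma card_fibre_le_powr:
  fixes M :: "'a::{field,finite} mat"
  assumes M: "M \<in> carrier_mat t k" and X: "X \<in> comp_class t n a b"
    and ab: "a \<ge> 1" "b \<ge> 1" and n: "n = (CARD('a) ^ t - 1) * a + b" and Q: "1 < CARD('a) ^ t"
  defines "h \<equiv> fibre_rate (CARD('a) ^ t) (a / n) (b / n) (CARD('a) ^ t) / ln (CARD('a) ^ t)"
  shows "real (card {G \<in> carrier_mat k n. X + M * G \<in> comp_class t n a b}) \<le>
    CARD('a) ^ (k * n) * real (card (mat_range k M)) powr (n * (h - 1))"
proof -
  define w where "w = card (mat_range k M)"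
  define Q where "Q = CARD('a) ^ t"
  define p \<beta> where "p = real a / real n" and "\<beta> = real b / real n"
  have w: "1 \<le> w" "w \<le> Q" using mat_range_bounds[OF M] by (auto simp: w_def Q_def)
  have n0: "n > 0" using ab n by simp
  have pos: "p > 0" "\<beta> > 0" using ab n0 by (auto simp: p_def \<beta>_def)
  have Q1: "1 < Q" using Q by (simp add: Q_def)
  hence lnQ: "ln (real Q) > 0" by simp
  define c where "c = real (card {G \<in> carrier_mat k n. X + M * G \<in> comp_class t n a b})"
  have "c * (\<beta> ^ b * p ^ ((Q - 1) * a)) \<le> (CARD('a) ^ k / w) ^ n *
     (exp (real n * fibre_rate Q p \<beta> w) * (\<beta> ^ b * p ^ ((Q - 1) * a)))"
    using card_fibre_le[OF M X, of p \<beta>] pos exp_fibre_rate[OF ab w] n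
    unfolding w_def c_def p_def \<beta>_def Q_def by simp
  hence "c \<le> (CARD('a) ^ k / w) ^ n * exp (real n * fibre_rate Q p \<beta> w)"
    using pos by simp
  also have "\<dots> \<le> (CARD('a) ^ k / w) ^ n * exp (real n * (ln w * h))"
  proof -
    have "fibre_rate Q p \<beta> w * ln Q \<le> ln w * fibre_rate Q p \<beta> Q"
      using fibre_rate_le[of p \<beta> w Q] pos w Q1 by simp
    hence "fibre_rate Q p \<beta> w \<le> ln w * h"
      using lnQ by (simp add: h_def field_simps Q_def p_def \<beta>_def)
    thus ?thesis by (intro mult_left_mono) (auto intro!: mult_left_mono)
  qed
  also have "(CARD('a) ^ k / w) ^ n = CARD('a) ^ (k * n) * real w powr (- real n)"
    using w by (simp add: power_mult_distrib power_inverse power_mult powr_minus powr_realpow divide_inverse)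
  also have "exp (real n * (ln w * h)) = real w powr (n * h)"
    using w by (simp add: powr_def mult_ac)
  finally show ?thesis
    using w by (simp add: c_def w_def mult.assoc powr_add[symmetric] algebra_simps)
qed

text \<open>The left side equals \<open>n ^ n / (a ^ ((Q - 1) * a) * b ^ b)\<close> with
  \<open>Q = CARD('a) ^ t\<close>, which \<open>mult_fact_power_le\<close> compares with the
  multinomial coefficient.\<close>

lemma card_comp_class_ge:
  assumes ab: "a \<ge> 1" "b \<ge> 1" and n: "n = (CARD('a::{zero,finite}) ^ t - 1) * a + b"
    and Q: "1 < CARD('a) ^ t"
  defines "h \<equiv> fibre_rate (CARD('a) ^ t) (a / n) (b / n) (CARD('a) ^ t) / ln (CARD('a) ^ t)"
  shows "real (CARD('a) ^ t) powr (n * h) \<le>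
    card (comp_class t n a b :: 'a mat set) * (exp 1 * n) ^ (CARD('a) ^ t)"
proof -
  define Q where "Q = CARD('a) ^ t"
  define p \<beta> where "p = real a / real n" and "\<beta> = real b / real n"
  have n0: "n > 0" using ab n by simp
  have pos: "p > 0" "\<beta> > 0" using ab n0 by (auto simp: p_def \<beta>_def)
  have n': "n = (Q - 1) * a + b" and Q1: "1 < Q" using n Q by (auto simp: Q_def)
  have lnQ: "ln (real Q) > 0" using Q1 by simp
  have "real Q powr (n * h) = exp (n * fibre_rate Q p \<beta> Q)"
    using Q1 lnQ by (simp add: powr_def h_def Q_def p_def \<beta>_def mult.commute)
  also have "\<dots> = 1 / (\<beta> ^ b * p ^ ((Q - 1) * a))"
  proof -
    have "\<beta> + (real Q - 1) * p = (real b + (real Q - 1) * real a) / real n"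
      unfolding p_def \<beta>_def by (simp only: add_divide_distrib times_divide_eq_right)
    also have "real b + (real Q - 1) * real a = real n"
      using Q1 by (simp add: n')
    finally have "\<beta> + (real Q - 1) * p = 1" using n0 by simp
    hence "exp (real n * fibre_rate Q p \<beta> Q) * (\<beta> ^ b * p ^ ((Q - 1) * a)) = 1"
      unfolding p_def \<beta>_def using exp_fibre_rate[OF ab _ order_refl n'] Q1 by simp
    thus ?thesis using pos by (simp add: eq_divide_eq)
  qed
  also have "\<dots> = real n ^ n / (real a ^ ((Q - 1) * a) * real b ^ b)"
    using arg_cong[OF n', of "\<lambda>m. real n ^ m"] n0
    by (simp add: p_def \<beta>_def power_divide power_add mult.commute)
  also have "\<dots> \<le> fact n / (fact a ^ (Q - 1) * fact b) * (exp 1 * real n) ^ (Q - 1 + 1)"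
    using mult_fact_power_le[OF ab, of "Q - 1"] ab unfolding n'[symmetric]
    by (simp add: divide_le_eq mult_ac)
  also have "\<dots> = card (comp_class t n a b :: 'a mat set) * (exp 1 * n) ^ Q"
    using card_comp_class[OF n] Q1 by (simp add: Q_def)
  finally show ?thesis by (simp add: Q_def)
qed

text \<open>Averaging over all \<open>G\<close>: after exchanging the sums,
  \<open>card_fibre_le_powr\<close> bounds each pair of \<open>M\<close> and \<open>X\<close>, and
  \<open>sum_mat_range_le\<close> bounds the sum over \<open>M\<close>.\<close>

lemma exists_small_collision_mat:
  fixes h :: real
  assumes ab: "a \<ge> 1" "b \<ge> 1" and n: "n = (CARD('a::{field,finite}) ^ t - 1) * a + b"
    and Q: "1 < CARD('a) ^ t"
  defines "h \<equiv> fibre_rate (CARD('a) ^ t) (a / n) (b / n) (CARD('a) ^ t) / ln (CARD('a) ^ t)"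
  assumes k: "k \<le> n * (1 - h) + 1"
  defines "T \<equiv> comp_class t n a b :: 'a mat set"
  shows "\<exists>G\<in>carrier_mat k n. (\<Sum>M\<in>carrier_mat t k. real (card {X \<in> T. X + M * G \<in> T})) \<le>
    2 ^ (CARD('a) ^ t) * CARD('a) ^ t * card T"
proof (rule ccontr)
  define C where "C = 2 ^ (CARD('a) ^ t) * real (CARD('a) ^ t)"
  let ?Z = "carrier_mat t k :: 'a mat set" and ?G = "carrier_mat k n :: 'a mat set"
  assume "\<not> ?thesis"
  hence *: "C * card T < (\<Sum>M\<in>?Z. real (card {X \<in> T. X + M * G \<in> T}))" if "G \<in> ?G" for G
    using that by (force simp: C_def)
  have finT: "finite T" by (simp add: T_def comp_class_def)
  have "card ?G * (C * card T) = (\<Sum>G\<in>?G. C * card T)" by simp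
  also have "\<dots> < (\<Sum>G\<in>?G. \<Sum>M\<in>?Z. real (card {X \<in> T. X + M * G \<in> T}))"
    using zero_carrier_mat[of k n] by (intro sum_strict_mono *) (simp, blast, simp)
  also have "\<dots> = (\<Sum>G\<in>?G. \<Sum>M\<in>?Z. \<Sum>X\<in>T. of_bool (X + M * G \<in> T))"
    using finT by (simp add: of_bool_def sum.inter_filter[symmetric])
  also have "\<dots> = (\<Sum>M\<in>?Z. \<Sum>X\<in>T. \<Sum>G\<in>?G. of_bool (X + M * G \<in> T))"
    by (subst sum.swap, intro sum.cong refl sum.swap)
  also have "\<dots> = (\<Sum>M\<in>?Z. \<Sum>X\<in>T. real (card {G \<in> ?G. X + M * G \<in> T}))"
    by (simp add: of_bool_def sum.inter_filter[symmetric])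
  also have "\<dots> \<le> (\<Sum>M\<in>?Z. \<Sum>X\<in>T. CARD('a) ^ (k * n) * real (card (mat_range k M)) powr (n * (h - 1)))"
    unfolding T_def h_def by (intro sum_mono card_fibre_le_powr ab n Q)
  also have "\<dots> = card T * CARD('a) ^ (k * n) * (\<Sum>M\<in>?Z. real (card (mat_range k M)) powr (n * (h - 1)))"
    by (simp add: sum_distrib_left mult.assoc)
  also have "\<dots> \<le> card T * CARD('a) ^ (k * n) * C"
  proof -
    \<comment> \<open>The upper bound on \<open>k\<close> leaves an exponent of at most 1; this
      excess is the room for rounding \<open>k\<close> up to an integer.\<close>
    have "real w ^ k * real w powr (n * (h - 1)) \<le> real (CARD('a) ^ t)"
      if w: "1 \<le> w" "w \<le> CARD('a) ^ t" for w :: nat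
    proof -
      have "real w ^ k * real w powr (n * (h - 1)) = real w powr (k - n * (1 - h))"
        using w by (simp add: powr_realpow[symmetric] powr_add[symmetric] algebra_simps)
      also have "\<dots> \<le> real w powr 1" using w k by (intro powr_mono) auto
      also have "\<dots> \<le> real (CARD('a) ^ t)" using w by (simp flip: of_nat_power)
      finally show ?thesis .
    qed
    hence "(\<Sum>M\<in>?Z. real (card (mat_range k M)) powr (n * (h - 1))) \<le> C"
      unfolding C_def by (intro sum_mat_range_le) auto
    thus ?thesis by (intro mult_left_mono) auto
  qed
  finally show False by (simp add: mult_ac)
qed

text \<open>For a \<open>G\<close> with few collisions, Cauchy-Schwarz makes the image nearly as
  large as the set of pairs, and the number of pairs is at least that of all matrices up to a
  polynomial factor.\<close>

lemma exists_large_sumset: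
  fixes h :: real
  assumes ab: "a \<ge> 1" "b \<ge> 1" and n: "n = (CARD('a::{field,finite}) ^ t - 1) * a + b"
    and Q: "1 < CARD('a) ^ t"
  defines "h \<equiv> fibre_rate (CARD('a) ^ t) (a / n) (b / n) (CARD('a) ^ t) / ln (CARD('a) ^ t)"
  assumes k: "n * (1 - h) \<le> k" "k \<le> n * (1 - h) + 1"
  defines "T \<equiv> comp_class t n a b :: 'a mat set"
  shows "\<exists>G\<in>carrier_mat k n. real (CARD('a) ^ (t * n)) \<le>
    2 ^ (CARD('a) ^ t) * CARD('a) ^ t * (exp 1 * n) ^ (CARD('a) ^ t) *
    card ((\<lambda>(M, X). M * G + X) ` (carrier_mat t k \<times> T))"
proof -
  define C where "C = 2 ^ (CARD('a) ^ t) * real (CARD('a) ^ t)"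
  let ?Z = "carrier_mat t k :: 'a mat set" and ?Q = "real (CARD('a) ^ t)"
  obtain G where G: "G \<in> carrier_mat k n" 
    and le: "(\<Sum>M\<in>?Z. real (card {X \<in> T. X + M * G \<in> T})) \<le> C * card T"
    using exists_small_collision_mat[OF ab n Q, of k] k unfolding C_def T_def h_def by auto
  define f where "f = (\<lambda>(M, X). M * G + X)"
  define I where "I = f ` (?Z \<times> T)"
  have T: "T \<subseteq> carrier_mat t n" by (auto simp: T_def comp_class_def)
  hence finT: "finite T" by (rule finite_subset) simp
  define S where "S = {(x, y) \<in> (?Z \<times> T) \<times> (?Z \<times> T). f x = f y}"
  \<comment> \<open>A collision is encoded by its first coefficient matrix, the difference of the
    two, and its first element of \<open>T\<close>; the second element of \<open>T\<close> is then
    forced.\<close>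
  let ?S' = "?Z \<times> (SIGMA M:?Z. {X \<in> T. X + M * G \<in> T})"
  have key: "X' = X + (M - M') * G"
    if "M \<in> ?Z" "M' \<in> ?Z" "X \<in> T" "X' \<in> T" "M * G + X = M' * G + X'" for M M' X X'
  proof (rule eq_matI)
    have c: "X \<in> carrier_mat t n" "X' \<in> carrier_mat t n" using that T by auto
    fix i j assume ij: "i < dim_row (X + (M - M') * G)" "j < dim_col (X + (M - M') * G)"
    hence ij': "i < t" "j < n" using that G c by auto
    define A where "A = M * G"
    define B where "B = M' * G"
    have AB: "A \<in> carrier_mat t n" "B \<in> carrier_mat t n" using that G by (auto simp: A_def B_def)
    have "(A + X) $$ (i, j) = (B + X') $$ (i, j)" using that by (simp add: A_def B_def)
    hence "A $$ (i, j) + X $$ (i, j) = B $$ (i, j) + X' $$ (i, j)"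
      using ij' AB c by simp
    moreover have "(M - M') * G = A - B"
      using that G by (simp add: A_def B_def minus_mult_distrib_mat)
    ultimately show "X' $$ (i, j) = (X + (M - M') * G) $$ (i, j)"
      using ij' AB c by (simp add: algebra_simps)
  qed (use that T G in auto)
  define g where "g = (\<lambda>((M, X), (M', X' :: 'a mat)). (M, M - M' :: 'a mat, X :: 'a mat))"
  have "card S \<le> card ?S'"
  proof (rule card_inj_on_le)
    show "inj_on g S"
    proof (rule inj_onI)
      fix x y assume xy: "x \<in> S" "y \<in> S"
        and eq: "g x = g y"
      obtain M X M' X' where x: "x = ((M, X), (M', X'))" by (metis surj_pair)
      obtain M2 X2 M2' X2' where y: "y = ((M2, X2), (M2', X2'))" by (metis surj_pair)
      have d: "M - M' = M - M2'" "M2 = M" "X2 = X" using eq by (auto simp: x y g_def)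
      have m: "M \<in> ?Z" "M' \<in> ?Z" "M2' \<in> ?Z" and t: "X \<in> T" "X' \<in> T" "X2' \<in> T"
        and e: "M * G + X = M' * G + X'" "M * G + X = M2' * G + X2'"
        using xy d by (auto simp: x y S_def f_def)
      have "X' = X2'" using key[OF m(1,2) t(1,2) e(1)] key[OF m(1,3) t(1,3) e(2)] d by simp
      moreover have "M' = M2'"
      proof (rule eq_matI)
        fix i j assume "i < dim_row M2'" "j < dim_col M2'"
        thus "M' $$ (i, j) = M2' $$ (i, j)"
          using m arg_cong[OF d(1), of "\<lambda>A. A $$ (i, j)"] by auto
      qed (use m in auto)
      ultimately show "x = y" by (simp add: x y d)
    qed
    show "g ` S \<subseteq> ?S'"
    proof
      fix z assume "z \<in> g ` S"
      then obtain x where x: "x \<in> S" "z = g x" by auto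
      obtain M X M' X' where x': "x = ((M, X), (M', X'))" by (metis surj_pair)
      have m: "M \<in> ?Z" "M' \<in> ?Z" "X \<in> T" "X' \<in> T" "M * G + X = M' * G + X'"
        using x(1) by (auto simp: x' S_def f_def)
      show "z \<in> ?S'"
        using m key[OF m] by (simp add: x(2) x' g_def minus_carrier_mat)
    qed
    show "finite ?S'" using finT by auto
  qed
  also have "\<dots> = card ?Z * (\<Sum>M\<in>?Z. card {X \<in> T. X + M * G \<in> T})"
    using finT by (simp add: card_cartesian_product card_SigmaI)
  finally have "real (card S) \<le> real (card ?Z * (\<Sum>M\<in>?Z. card {X \<in> T. X + M * G \<in> T}))"
    by (simp only: of_nat_le_iff)
  also have "\<dots> = real (card ?Z) * (\<Sum>M\<in>?Z. real (card {X \<in> T. X + M * G \<in> T}))"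
    by (simp only: of_nat_mult of_nat_sum)
  also have "\<dots> \<le> real (card ?Z) * (C * card T)" by (intro mult_left_mono le) simp
  finally have S: "real (card S) \<le> C * (real (card ?Z) * card T)" by (simp add: mult_ac)
  have "(card (?Z \<times> T))\<^sup>2 \<le> card I * card S"
    unfolding I_def S_def using finT by (intro card_power2_le_image_mult_collisions) auto
  hence "real ((card (?Z \<times> T))\<^sup>2) \<le> real (card I * card S)"
    by (simp only: of_nat_le_iff)
  hence "(real (card ?Z) * card T)\<^sup>2 \<le> real (card I) * card S"
    by (simp add: card_cartesian_product del: card_carrier_mat)
  also have "\<dots> \<le> real (card I) * (C * (real (card ?Z) * card T))"
    by (intro mult_left_mono S) simp
  finally have main: "(real (card ?Z) * card T) * (real (card ?Z) * card T) \<le> (C * card I) * (real (card ?Z) * card T)"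
    by (simp add: power2_eq_square mult_ac)
  \<comment> \<open>The lower bound on \<open>k\<close> lets \<open>?Z\<close> supply the first
    factor; the composition class supplies the second up to a polynomial.\<close>
  have "?Q ^ n = ?Q powr (n * (1 - h)) * ?Q powr (n * h)"
    using Q by (simp add: powr_add[symmetric] powr_realpow[symmetric] algebra_simps del: of_nat_power)
  also have "\<dots> \<le> ?Q powr k * (card T * (exp 1 * n) ^ (CARD('a) ^ t))"
    using card_comp_class_ge[OF ab n Q] k Q unfolding h_def T_def
    by (intro mult_mono powr_mono) auto
  also have "?Q powr k = card ?Z"
    using Q by (simp add: powr_realpow power_mult)
  finally have lower: "?Q ^ n \<le> (real (card ?Z) * card T) * (exp 1 * n) ^ (CARD('a) ^ t)"
    by (simp add: mult_ac)
  have "0 < ?Q ^ n" by simp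
  hence "0 < (real (card ?Z) * card T) * (exp 1 * n) ^ (CARD('a) ^ t)" using lower by linarith
  hence "0 < real (card ?Z) * card T"
    by (metis less_eq_real_def mult_nonneg_nonneg mult_zero_left of_nat_0_le_iff order_less_irrefl)
  with main have "real (card ?Z) * card T \<le> C * card I" by (rule mult_right_le_imp_le)
  hence "(real (card ?Z) * card T) * (exp 1 * n) ^ (CARD('a) ^ t) \<le> (C * card I) * (exp 1 * n) ^ (CARD('a) ^ t)"
    by (intro mult_right_mono) auto
  with lower have "?Q ^ n \<le> (C * card I) * (exp 1 * n) ^ (CARD('a) ^ t)" by linarith
  moreover have "?Q ^ n = real (CARD('a) ^ (t * n))" by (simp add: power_mult)
  ultimately show ?thesis
    using G unfolding C_def I_def f_def by (intro bexI[of _ G]) (simp_all only: mult_ac of_nat_mult of_nat_power of_nat_numeral)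
qed

subsection \<open>Squaring the uncovered fraction\<close>

abbreviation lin_span :: "nat \<Rightarrow> 'a::field vec set \<Rightarrow> 'a vec set" where
  "lin_span n S \<equiv> LinearCombinations.module.span class_ring (module_vec TYPE('a) n) S"

lemma linear_code_lin_span:
  fixes S :: "'a::field vec set"
  assumes "S \<subseteq> carrier_vec n"
  shows "linear_code n (lin_span n S)"
proof -
  interpret vec_space "TYPE('a)" n .
  show ?thesis unfolding linear_code_def using span_is_subspace[of S] assms by simp
qed

text \<open>Spans do not depend on the ambient space, so \<open>S\<close> still generates the code
  regarded as a vector space of its own.\<close>

lemma code_dim_lin_span_le:
  fixes S :: "'a::field vec set"
  assumes "S \<subseteq> carrier_vec n" "finite S"
  shows "code_dim n (lin_span n S) \<le> card S"
proof -
  interpret vec_space "TYPE('a)" n .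
  have sub: "VectorSpace.subspace class_ring (span S) V" using assms(1) by (intro span_is_subspace) simp
  interpret W: vectorspace class_ring "vs (span S)" using sub by (rule subspace_is_vs)
  have S: "S \<subseteq> span S" using assms(1) by (intro in_own_span) simp
  have "W.span S = span S"
    using span_li_not_depend(1)[OF S] sub unfolding VectorSpace.subspace_def by simp
  hence "W.dim \<le> card S" using assms(2) S by (intro W.gen_ge_dim) auto
  thus ?thesis by (simp add: code_dim_def)
qed

lemma covering_radius_le:
  fixes C :: "'a::finite vec set"
  assumes "\<And>U. U \<in> carrier_mat t n \<Longrightarrow> \<exists>A\<in>code_power t n C. t_distance A U \<le> r"
  shows "covering_radius t n C \<le> r"
proof -
  have fin: "finite (code_power t n C)" by (simp add: code_power_def)
  have "Min ((\<lambda>A. t_distance A U) ` code_power t n C) \<le> r" if "U \<in> carrier_mat t n" for U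
    using assms[OF that] fin by (auto intro: Min.coboundedI order_trans)
  moreover have "mat t n (\<lambda>_. undefined) \<in> (carrier_mat t n :: 'a mat set)" by simp
  hence "(carrier_mat t n :: 'a mat set) \<noteq> {}" by blast
  ultimately show ?thesis unfolding covering_radius_def by (subst Max_le_iff) auto
qed

text \<open>Indexed by a generating set rather than by the code, so that counting generators bounds
  the dimension.\<close>

definition covered :: "nat \<Rightarrow> nat \<Rightarrow> 'a mat set \<Rightarrow> 'a::field vec set \<Rightarrow> 'a mat set" where
  "covered t n T S = {A + X | A X. A \<in> code_power t n (lin_span n S) \<and> X \<in> T}"

text \<open>Row \<open>i\<close> of \<open>M * G\<close> combines the rows of \<open>G\<close> with
  the entries of row \<open>i\<close> of \<open>M\<close> as coefficients.\<close>

lemma covered_mult_mat: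
  fixes G :: "'a::field mat"
  assumes "G \<in> carrier_mat k n" "M \<in> carrier_mat t k" "X \<in> T"
  shows "M * G + X \<in> covered t n T (set (rows G))"
proof -
  interpret vec_space "TYPE('a)" n .
  have "row (M * G) i \<in> span (set (rows G))" if "i < t" for i
  proof -
    have "row (M * G) i = G\<^sup>T *\<^sub>v row M i"
      using assms that by (intro eq_vecI) (auto simp: comm_scalar_prod[of _ k])
    thus ?thesis using row_space_eq[OF assms(1)] assms that
      unfolding row_space_def by auto
  qed
  moreover have "M * G \<in> carrier_mat t n" using assms by simp
  ultimately have "M * G \<in> code_power t n (span (set (rows G)))" unfolding code_power_def by blast
  thus ?thesis using assms(3) unfolding covered_def by blast
qed

lemma code_power_add:
  fixes A B :: "'a::field mat"
  assumes "S \<subseteq> carrier_vec n" "A \<in> code_power t n (lin_span n S)" "B \<in> code_power t n (lin_span n S)"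
  shows "A + B \<in> code_power t n (lin_span n S)"
proof -
  interpret vec_space "TYPE('a)" n .
  have "row (A + B) i \<in> span S" if "i < t" for i
  proof -
    have "row (A + B) i = row A i + row B i"
      using assms that by (intro eq_vecI) (auto simp: code_power_def)
    thus ?thesis using assms that span_add1[of S "row A i" "row B i"] by (simp add: code_power_def)
  qed
  thus ?thesis using assms by (simp add: code_power_def)
qed

lemma code_power_mono:
  fixes S S' :: "'a::field vec set"
  assumes "S \<subseteq> S'"
  shows "code_power t n (lin_span n S) \<subseteq> code_power t n (lin_span n S')"
proof -
  interpret vec_space "TYPE('a)" n .
  show ?thesis using span_is_monotone[OF assms] by (auto simp: code_power_def)
qed

lemma rows_in_code_power:
  fixes X :: "'a::field mat"
  assumes "X \<in> carrier_mat t n"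
  shows "X \<in> code_power t n (lin_span n (set (rows X)))"
proof -
  interpret vec_space "TYPE('a)" n .
  have "set (rows X) \<subseteq> carrier_vec n" using assms by (auto simp: rows_def)
  hence "set (rows X) \<subseteq> span (set (rows X))" by (intro in_own_span) simp
  thus ?thesis using assms by (auto simp: code_power_def rows_def)
qed

text \<open>Adjoining the rows of \<open>X\<close> puts \<open>X\<close> itself into the power of
  the enlarged code, which is closed under addition.\<close>

lemma covered_Un_rows:
  fixes X :: "'a::field mat"
  assumes S: "S \<subseteq> carrier_vec n" and X: "X \<in> carrier_mat t n" and T: "T \<subseteq> carrier_mat t n"
  shows "covered t n T S \<subseteq> covered t n T (S \<union> set (rows X))"
    "(\<lambda>U. U + X) ` covered t n T S \<subseteq> covered t n T (S \<union> set (rows X))"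
proof -
  let ?P = "\<lambda>S. code_power t n (lin_span n S)"
  have S': "S \<union> set (rows X) \<subseteq> carrier_vec n" using S X by (auto simp: rows_def)
  show "covered t n T S \<subseteq> covered t n T (S \<union> set (rows X))"
    using code_power_mono[of S "S \<union> set (rows X)" t n] by (fastforce simp: covered_def)
  show "(\<lambda>U. U + X) ` covered t n T S \<subseteq> covered t n T (S \<union> set (rows X))"
  proof
    fix V assume "V \<in> (\<lambda>U. U + X) ` covered t n T S"
    then obtain A Y where A: "A \<in> ?P S" "Y \<in> T" "V = (A + Y) + X" by (auto simp: covered_def)
    have car: "A \<in> carrier_mat t n" "Y \<in> carrier_mat t n" using A T by (auto simp: code_power_def)
    have "A + X \<in> ?P (S \<union> set (rows X))"
      using A(1) code_power_mono[of S "S \<union> set (rows X)" t n] rows_in_code_power[OF X]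
        code_power_mono[of "set (rows X)" "S \<union> set (rows X)" t n]
      by (intro code_power_add[OF S']) auto
    moreover have "V = (A + X) + Y"
      using A(3) car X by (auto intro!: eq_matI)
    ultimately show "V \<in> covered t n T (S \<union> set (rows X))" using A by (auto simp: covered_def)
  qed
qed

text \<open>Adding all rows of a random matrix \<open>X\<close> makes \<open>U\<close> and \<open>U - X\<close> independent uniform matrices, so the
  uncovered density gets squared on average. A single random vector would not achieve this for \<open>t \<ge> 2\<close>.\<close>

lemma exists_squaring_rows:
  fixes S :: "'a::{field,finite} vec set"
  assumes S: "S \<subseteq> carrier_vec n" and T: "T \<subseteq> carrier_mat t n"
  shows "\<exists>X\<in>carrier_mat t n. card (carrier_mat t n - covered t n T (S \<union> set (rows X))) * CARD('a) ^ (t * n)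
    \<le> (card (carrier_mat t n - covered t n T S))\<^sup>2"
proof (rule ccontr)
  let ?V = "carrier_mat t n :: 'a mat set"
  define D where "D = ?V - covered t n T S"
  define D' where "D' X = ?V - covered t n T (S \<union> set (rows X))" for X
  assume "\<not> ?thesis"
  hence *: "(card D)\<^sup>2 < card (D' X) * CARD('a) ^ (t * n)" if "X \<in> ?V" for X
    using that by (force simp: D_def D'_def)
  have fin: "finite D" by (simp add: D_def)
  have DV: "D \<subseteq> ?V" by (auto simp: D_def)
  \<comment> \<open>If \<open>U\<close> stays uncovered after the rows of \<open>X\<close> are
    adjoined, then both \<open>U\<close> and \<open>U - X\<close> were uncovered before.\<close>
  have le: "card (D' X) \<le> card {U \<in> D. U - X \<in> D}" if X: "X \<in> ?V" for X
  proof (rule card_mono)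
    show "D' X \<subseteq> {U \<in> D. U - X \<in> D}"
    proof
      fix U assume U: "U \<in> D' X"
      hence "U \<in> ?V" by (simp add: D'_def)
      moreover from this have "(U - X) + X = U" "U - X \<in> ?V" using X by (auto intro!: eq_matI simp: minus_carrier_mat)
      ultimately show "U \<in> {U \<in> D. U - X \<in> D}"
        using U covered_Un_rows[OF S X T] unfolding D_def D'_def
        by (auto simp: image_subset_iff)
    qed
  qed (use fin in auto)
  have "card ?V * (card D)\<^sup>2 = (\<Sum>X\<in>?V. (card D)\<^sup>2)" by simp
  also have "\<dots> < (\<Sum>X\<in>?V. card (D' X) * CARD('a) ^ (t * n))"
    using zero_carrier_mat[of t n] by (intro sum_strict_mono *) (simp, blast, simp)
  also have "\<dots> \<le> (\<Sum>X\<in>?V. card {U \<in> D. U - X \<in> D} * CARD('a) ^ (t * n))"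
    by (intro sum_mono mult_right_mono le) auto
  also have "\<dots> = (\<Sum>X\<in>?V. card {U \<in> D. U - X \<in> D}) * CARD('a) ^ (t * n)"
    by (simp only: sum_distrib_right)
  also have "(\<Sum>X\<in>?V. card {U \<in> D. U - X \<in> D}) = (\<Sum>X\<in>?V. \<Sum>U\<in>D. of_bool (U - X \<in> D))"
    using fin by (simp add: of_bool_def sum.inter_filter[symmetric])
  also have "\<dots> = (\<Sum>U\<in>D. \<Sum>X\<in>?V. of_bool (U - X \<in> D))" by (rule sum.swap)
  also have "\<dots> = (\<Sum>U\<in>D. card {X \<in> ?V. U - X \<in> D})"
    by (simp add: of_bool_def sum.inter_filter[symmetric])
  \<comment> \<open>For fixed \<open>U\<close>, sending \<open>X\<close> to \<open>U - X\<close> is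
    its own inverse, so exactly \<open>card D\<close> choices of \<open>X\<close> land in
    \<open>D\<close>.\<close>
  also have "\<dots> = (\<Sum>U\<in>D. card D)"
  proof (intro sum.cong refl)
    fix U assume "U \<in> D"
    hence U: "U \<in> ?V" using DV by auto
    have "bij_betw (\<lambda>X. U - X) {X \<in> ?V. U - X \<in> D} D"
    proof (rule bij_betw_byWitness[of _ "\<lambda>X. U - X"])
      have inv: "U - (U - X) = X" if "X \<in> ?V" for X using U that by (auto intro!: eq_matI)
      show "\<forall>X\<in>{X \<in> ?V. U - X \<in> D}. U - (U - X) = X" "\<forall>X\<in>D. U - (U - X) = X" using inv DV by auto
      show "(\<lambda>X. U - X) ` D \<subseteq> {X \<in> ?V. U - X \<in> D}"
        using inv DV U by (auto simp: minus_carrier_mat)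
    qed auto
    thus "card {X \<in> ?V. U - X \<in> D} = card D" by (rule bij_betw_same_card)
  qed
  finally show False by (simp add: power2_eq_square mult_ac)
qed

text \<open>Each round applies \<open>exists_squaring_rows\<close> once, at the price of at most
  \<open>t\<close> further generators.\<close>

lemma exists_iterated_rows:
  fixes S :: "'a::{field,finite} vec set" and \<rho> :: real
  assumes S: "S \<subseteq> carrier_vec n" "finite S" and T: "T \<subseteq> carrier_mat t n"
    and \<rho>: "real (card (carrier_mat t n - covered t n T S)) \<le> \<rho> * CARD('a) ^ (t * n)"
  shows "\<exists>S'. S' \<subseteq> carrier_vec n \<and> finite S' \<and> card S' \<le> card S + t * s \<and>
    real (card (carrier_mat t n - covered t n T S')) \<le> \<rho> ^ (2 ^ s) * CARD('a) ^ (t * n)"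
proof (induction s)
  case 0
  thus ?case using assms by (intro exI[of _ S]) auto
next
  case (Suc s)
  define N where "N = real (CARD('a) ^ (t * n))"
  have N: "N > 0" by (simp add: N_def)
  define u where "u S = real (card (carrier_mat t n - covered t n T S))" for S :: "'a vec set"
  from Suc obtain S' where S': "S' \<subseteq> carrier_vec n" "finite S'" "card S' \<le> card S + t * s"
    "u S' \<le> \<rho> ^ (2 ^ s) * N" by (auto simp: N_def u_def)
  from exists_squaring_rows[OF S'(1) T] obtain X where X: "X \<in> carrier_mat t n"
    and "card (carrier_mat t n - covered t n T (S' \<union> set (rows X))) * CARD('a) ^ (t * n)
      \<le> (card (carrier_mat t n - covered t n T S'))\<^sup>2" by blast
  hence "real (card (carrier_mat t n - covered t n T (S' \<union> set (rows X))) * CARD('a) ^ (t * n))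
      \<le> real ((card (carrier_mat t n - covered t n T S'))\<^sup>2)" by (simp only: of_nat_le_iff)
  hence "u (S' \<union> set (rows X)) * N \<le> (u S')\<^sup>2"
    by (simp only: of_nat_mult of_nat_power u_def N_def)
  also have "\<dots> \<le> (\<rho> ^ (2 ^ s) * N)\<^sup>2"
    using S'(4) by (intro power_mono) (auto simp: u_def)
  also have "\<dots> = (\<rho> ^ (2 ^ Suc s) * N) * N"
    by (simp add: power_mult_distrib power2_eq_square mult_ac power_add[symmetric] mult_2)
  finally have "u (S' \<union> set (rows X)) \<le> \<rho> ^ (2 ^ Suc s) * N"
    using N by (rule mult_right_le_imp_le)
  moreover have "card (S' \<union> set (rows X)) \<le> card S + t * Suc s"
  proof -
    have "card (set (rows X)) \<le> t" using card_length[of "rows X"] X by simp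
    thus ?thesis using card_Un_le[of S' "set (rows X)"] S'(3) by simp
  qed
  moreover have "S' \<union> set (rows X) \<subseteq> carrier_vec n" using S' X by (auto simp: rows_def)
  ultimately show ?case using S'(2) unfolding u_def N_def
    by (intro exI[of _ "S' \<union> set (rows X)"]) auto
qed

text \<open>If \<open>U = A + X\<close>, then \<open>U\<close> and \<open>A\<close> differ exactly
  in the nonzero columns of \<open>X\<close>.\<close>

lemma covering_radius_le_of_covered:
  fixes S :: "'a::{field,finite} vec set"
  assumes cov: "carrier_mat t n \<subseteq> covered t n (comp_class t n a b) S"
  shows "covering_radius t n (lin_span n S) \<le> n - b"
proof (rule covering_radius_le)
  fix U :: "'a mat" assume U: "U \<in> carrier_mat t n"
  then obtain A X where A: "A \<in> code_power t n (lin_span n S)" and X: "X \<in> comp_class t n a b"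
    and eq: "U = A + X"
    using cov by (auto simp: covered_def)
  have car: "A \<in> carrier_mat t n" "X \<in> carrier_mat t n"
    using A X by (auto simp: code_power_def comp_class_def)
  have "col A j \<noteq> col U j \<longleftrightarrow> col X j \<noteq> 0\<^sub>v t" if "j < n" for j
  proof -
    have "col U j = col A j + col X j" using that car by (simp add: eq col_add)
    moreover have "x = x + y \<longleftrightarrow> y = 0\<^sub>v t" if "x \<in> carrier_vec t" "y \<in> carrier_vec t" for x y :: "'a vec"
      using that by (auto simp: vec_eq_iff)
    ultimately show ?thesis using that car by simp
  qed
  hence "t_distance A U = card {j. j < n \<and> col X j \<noteq> 0\<^sub>v t}"
    using car unfolding t_distance_def by (intro arg_cong[of _ _ card]) auto
  also have "\<dots> \<le> n - b" using card_nonzero_cols[OF X] by simp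
  finally show "\<exists>A\<in>code_power t n (lin_span n S). t_distance A U \<le> n - b" using A by blast
qed

text \<open>The rows of a good \<open>G\<close> cover at least a fraction \<open>1 / P\<close>.
  After \<open>s\<close> squarings the uncovered fraction is at most
  \<open>exp (- (2 ^ s / P))\<close>, which is less than one matrix out of all.\<close>

lemma exists_code:
  fixes h P :: real
  assumes ab: "a \<ge> 1" "b \<ge> 1" and n: "n = (CARD('a::{field,finite}) ^ t - 1) * a + b"
    and Q: "1 < CARD('a) ^ t"
  defines "h \<equiv> fibre_rate (CARD('a) ^ t) (a / n) (b / n) (CARD('a) ^ t) / ln (CARD('a) ^ t)"
  defines "P \<equiv> 2 ^ (CARD('a) ^ t) * CARD('a) ^ t * (exp 1 * n) ^ (CARD('a) ^ t)"
  assumes k: "n * (1 - h) \<le> k" "k \<le> n * (1 - h) + 1"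
    and s: "P * n * ln (CARD('a) ^ t) < 2 ^ s"
  shows "\<exists>C :: 'a vec set. linear_code n C \<and> covering_radius t n C \<le> n - b \<and> code_dim n C \<le> k + t * s"
proof -
  define T where "T = (comp_class t n a b :: 'a mat set)"
  define N where "N = real (CARD('a) ^ (t * n))"
  let ?V = "carrier_mat t n :: 'a mat set"
  have N: "N > 0" by (simp add: N_def)
  have n0: "n > 0" using ab n by simp
  hence P: "P > 0" by (simp add: P_def)
  have T: "T \<subseteq> ?V" by (auto simp: T_def comp_class_def)
  obtain G where G: "G \<in> carrier_mat k n"
    and le: "N \<le> P * card ((\<lambda>(M, X). M * G + X) ` (carrier_mat t k \<times> T))"
    using exists_large_sumset[OF ab n Q, of k] k unfolding h_def P_def T_def N_def by blast
  define S where "S = set (rows G)"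
  have S: "S \<subseteq> carrier_vec n" "finite S" "card S \<le> k"
    using G card_length[of "rows G"] by (auto simp: S_def rows_def)
  have covV: "covered t n T S \<subseteq> ?V"
    using T by (auto simp: covered_def code_power_def)
  hence fin: "finite (covered t n T S)" by (rule finite_subset) simp
  have "card ((\<lambda>(M, X). M * G + X) ` (carrier_mat t k \<times> T)) \<le> card (covered t n T S)"
    using covered_mult_mat[OF G] fin by (intro card_mono) (auto simp: S_def)
  hence "P * card ((\<lambda>(M, X). M * G + X) ` (carrier_mat t k \<times> T)) \<le> P * card (covered t n T S)"
    using P by (intro mult_left_mono) auto
  with le have "N \<le> P * card (covered t n T S)" by linarith
  hence cov: "N / P \<le> card (covered t n T S)" using P by (simp add: field_simps)
  have "card (?V - covered t n T S) + card (covered t n T S) = card ?V"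
    using covV fin by (metis add.commute card_Diff_subset card_mono finite_carrier_mat le_add_diff_inverse)
  hence "real (card (?V - covered t n T S)) + card (covered t n T S) = N"
    unfolding N_def by (simp flip: of_nat_add)
  hence "real (card (?V - covered t n T S)) \<le> (1 - 1 / P) * N" using cov by (simp add: algebra_simps)
  from exists_iterated_rows[OF S(1,2) T this[unfolded N_def], of s, folded N_def]
  obtain S' where S': "S' \<subseteq> carrier_vec n" "finite S'" "card S' \<le> card S + t * s"
    and u: "real (card (?V - covered t n T S')) \<le> (1 - 1 / P) ^ (2 ^ s) * N" by auto
  \<comment> \<open>Makes \<open>1 - 1 / P\<close> non-negative, so that its comparison with
    \<open>exp (- 1 / P)\<close> survives taking powers.\<close>
  have P1: "1 \<le> P"
  proof -
    have "card (covered t n T S) \<le> card ?V" using covV by (intro card_mono) auto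
    hence "real (card (covered t n T S)) \<le> N" by (simp add: N_def flip: of_nat_power)
    hence "N * 1 \<le> N * P" using \<open>N \<le> P * card (covered t n T S)\<close> P
      by (metis mult.commute mult.right_neutral mult_left_mono order_less_imp_le order_trans)
    thus ?thesis using N by simp
  qed
  have "(1 - 1 / P) ^ (2 ^ s) \<le> exp (- 1 / P) ^ (2 ^ s)"
    using P1 exp_ge_add_one_self[of "- 1 / P"] by (intro power_mono) auto
  also have "\<dots> = exp (- (2 ^ s / P))" by (simp flip: exp_of_nat_mult)
  also have "\<dots> < exp (- (n * ln (CARD('a) ^ t)))"
    using s P by (simp add: field_simps)
  also have "\<dots> = 1 / N"
  proof -
    have "N = real (CARD('a) ^ t) ^ n" by (simp add: N_def power_mult)
    also have "\<dots> = exp (n * ln (CARD('a) ^ t))" using Q by (simp add: exp_of_nat_mult)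
    finally show ?thesis by (simp add: exp_minus inverse_eq_divide)
  qed
  finally have "(1 - 1 / P) ^ (2 ^ s) * N < 1" using N by (simp add: field_simps)
  with u have "card (?V - covered t n T S') = 0" by linarith
  hence "?V \<subseteq> covered t n T S'" by simp
  hence "covering_radius t n (lin_span n S') \<le> n - b"
    unfolding T_def by (rule covering_radius_le_of_covered)
  moreover have "code_dim n (lin_span n S') \<le> k + t * s"
    using code_dim_lin_span_le[OF S'(1,2)] S'(3) S(3) by simp
  ultimately show ?thesis using linear_code_lin_span[OF S'(1)] by blast
qed

subsection \<open>Asymptotics\<close>

lemma entropy_eq_ln:
  "entropy n x = (x * ln (real n - 1) - x * ln x - (1 - x) * ln (1 - x)) / ln n"
  by (simp add: entropy_def log_def diff_divide_distrib)

text \<open>Spreading the mass \<open>x\<close> evenly over the \<open>n - 1\<close> nonzero symbols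
  turns the Shannon entropy of \<open>fibre_rate_top\<close> into the entropy function.\<close>

lemma entropy_eq_fibre_rate:
  fixes x Q :: real
  assumes "0 < x" "x < 1" "1 < real n"
  shows "entropy n x = fibre_rate n (x / (real n - 1)) (1 - x) n / ln n"
proof -
  have "fibre_rate n (x / (real n - 1)) (1 - x) n = - (1 - x) * ln (1 - x) - x * (ln x - ln (real n - 1))"
    using assms fibre_rate_top[of "1 - x" n "x / (real n - 1)"] by (simp add: ln_div)
  thus ?thesis by (simp add: entropy_eq_ln left_diff_distrib right_diff_distrib)
qed

text \<open>By the mean value theorem, with \<open>ln (1 - z) \<le> 0\<close> dropped from the
  derivative. It controls the loss from rounding \<theta> down to an attainable relative
  weight.\<close>

lemma entropy_increment_le:
  assumes "0 < c" "c \<le> x" "x \<le> y" "y < 1" "1 < real Q"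
  shows "entropy Q y - entropy Q x \<le> (ln (real Q - 1) - ln c) / ln Q * (y - x)"
proof (cases "x = y")
  case False
  hence xy: "x < y" using assms by simp
  have deriv: "((\<lambda>x. entropy Q x) has_real_derivative (ln (real Q - 1) - ln z + ln (1 - z)) / ln Q) (at z)"
    if "x \<le> z" "z \<le> y" for z
  proof -
    have z: "0 < z" "z < 1" using that assms by auto
    have "((\<lambda>x. x * ln (real Q - 1) - x * ln x - (1 - x) * ln (1 - x)) has_real_derivative
        ln (real Q - 1) - ln z + ln (1 - z)) (at z)"
      using z by (auto intro!: derivative_eq_intros)
    thus ?thesis unfolding entropy_eq_ln by (rule DERIV_cdivide)
  qed
  from MVT2[OF xy deriv] obtain z where
    z: "x < z" "z < y" "entropy Q y - entropy Q x = (y - x) * ((ln (real Q - 1) - ln z + ln (1 - z)) / ln Q)"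
    by blast
  have "ln (1 - z) \<le> 0" "ln c \<le> ln z" using z assms by (auto simp: ln_le_zero_iff)
  hence "(ln (real Q - 1) - ln z + ln (1 - z)) / ln Q \<le> (ln (real Q - 1) - ln c) / ln Q"
    using assms by (intro divide_right_mono) auto
  from mult_left_mono[OF this, of "y - x"] show ?thesis
    unfolding z(3) using xy by (simp only: mult.commute)
qed simp

lemma two_le_card_field: "2 \<le> CARD('a::{field,finite})"
  using card_mono[of UNIV "{0, 1 :: 'a}"] by simp

theorem theorem11:
  fixes q t :: nat and \<theta> :: real
  assumes "CARD('a::{field,finite}) = q"
    and "t \<ge> 2"
    and "\<theta> \<in> \<rat>"
    and "0 < \<theta>"
    and "\<theta> < 1 - 1 / real q ^ t"
  shows "\<exists>K::real. \<exists>N::nat. \<forall>n\<ge>N. \<exists>C :: 'a vec set.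
           linear_code n C \<and>
           real (covering_radius t n C) \<le> \<theta> * real n \<and>
           real (code_dim n C) \<le> real n * (1 - entropy (q ^ t) \<theta>) + K * ln (real n)"
proof -
  define Q where "Q = q ^ t"
  have q2: "q \<ge> 2" using two_le_card_field[where 'a='a] assms(1) by simp
  have "q ^ 1 \<le> q ^ t" using q2 assms(2) by (intro power_increasing) auto
  hence Q2: "Q \<ge> 2" using q2 by (simp add: Q_def)
  have "1 / real q ^ t > 0" using q2 by simp
  hence \<theta>: "0 < \<theta>" "\<theta> < 1" using assms(4,5) by linarith+
  \<comment> \<open>The slope bound of \<open>entropy_increment_le\<close> on the interval from
    \<open>\<theta> / 2\<close> to \<theta>.\<close>
  define L where "L = (ln (real Q - 1) - ln (\<theta> / 2)) / ln Q"
  have L: "L \<ge> 0"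
  proof -
    have "ln (\<theta> / 2) \<le> 0" "ln (real Q - 1) \<ge> 0" "ln (real Q) > 0"
      using \<theta> Q2 by (auto simp: ln_le_zero_iff)
    thus ?thesis by (simp add: L_def)
  qed
  define c where "c = 2 ^ Q * real Q * exp 1 ^ Q * ln (real Q)"
  obtain A where A: "c < 2 ^ A" using real_arch_pow[of 2 c] by auto
  \<comment> \<open>\<open>K0\<close> collects the rounding loss of the entropy, the 1 lost in
    rounding \<open>k\<close> up, and the constant part of \<open>t * s\<close>; \<open>K1\<close>
    is the coefficient of \<open>ln n\<close> in \<open>t * s\<close>.\<close>
  define K0 where "K0 = L * (real Q - 1) + 1 + real t * (real A + (real Q + 1))"
  define K1 where "K1 = real t * (real Q + 1) / ln 2"
  have K0: "K0 \<ge> 0" using L Q2 by (simp add: K0_def)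
  \<comment> \<open>The first term keeps the rounded weight above \<open>\<theta> / 2\<close>; the
    summand 3 gives \<open>ln n \<ge> 1\<close>, so that constants are absorbed into the
    logarithm.\<close>
  define N where "N = nat \<lceil>2 * (real Q - 1) / \<theta>\<rceil> + 3"
  show ?thesis
  proof (rule exI[of _ "K0 + K1"], rule exI[of _ N], intro allI impI)
    fix n :: nat assume nN: "N \<le> n"
    have n3: "n \<ge> 3" using nN by (simp add: N_def)
    have "2 * (real Q - 1) / \<theta> \<le> real n" using nN unfolding N_def by linarith
    hence nQ: "(real Q - 1) / real n \<le> \<theta> / 2" using n3 \<theta> by (simp add: field_simps)
    \<comment> \<open>The largest multiplicity with \<open>(Q - 1) * a \<le> \<theta> * n\<close>;
      below, \<open>x\<close> is the relative weight actually attained.\<close>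
    define a where "a = nat \<lfloor>\<theta> * real n / (real Q - 1)\<rfloor>"
    define b where "b = n - (Q - 1) * a"
    define x where "x = (real Q - 1) * real a / real n"
    have a: "real a \<le> \<theta> * real n / (real Q - 1)" "\<theta> * real n / (real Q - 1) < real a + 1"
      using \<theta> Q2 unfolding a_def by (auto intro!: divide_nonneg_nonneg)
    have xa: "(real Q - 1) * real a \<le> \<theta> * real n" "\<theta> * real n < (real Q - 1) * real a + (real Q - 1)"
      using a Q2 by (simp_all add: field_simps)
    have x: "x \<le> \<theta>" "n * (\<theta> - x) \<le> real Q - 1" "\<theta> - x \<le> \<theta> / 2"
    proof -
      show "x \<le> \<theta>" using xa(1) n3 by (simp add: x_def field_simps)
      show "n * (\<theta> - x) \<le> real Q - 1" using xa(2) n3 by (simp add: x_def right_diff_distrib mult.commute[of \<theta>])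
      hence "\<theta> - x \<le> (real Q - 1) / n" using n3 by (simp add: field_simps)
      thus "\<theta> - x \<le> \<theta> / 2" using nQ by linarith
    qed
    hence x01: "0 < x" "x < 1" "\<theta> / 2 \<le> x" using \<theta> by auto
    have a1: "a \<ge> 1" using x01(1) by (cases a) (auto simp: x_def)
    have Qa: "real ((Q - 1) * a) = (real Q - 1) * real a" using Q2 by simp
    have "\<theta> * real n < 1 * real n" using \<theta> n3 by (intro mult_strict_right_mono) auto
    hence "real ((Q - 1) * a) < real n" using xa(1) Qa by linarith
    hence "(Q - 1) * a < n" by (simp only: of_nat_less_iff)
    hence b1: "b \<ge> 1" and n_eq: "n = (Q - 1) * a + b" by (simp_all add: b_def)
    have nb: "real (n - b) \<le> \<theta> * real n"
    proof -
      have "n - b = (Q - 1) * a" using n_eq by (metis add_diff_cancel_right')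
      thus ?thesis using xa(1) Qa by (simp only:)
    qed
    have h: "fibre_rate Q (a / n) (b / n) Q / ln Q = entropy Q x"
    proof -
      have "real a / n = x / (real Q - 1)" using Q2 by (simp add: x_def)
      moreover have "real b / n = 1 - x"
      proof -
        have "real b = real n - (real Q - 1) * real a" using n_eq Qa by linarith
        thus ?thesis using n3 by (simp add: x_def diff_divide_distrib)
      qed
      ultimately show ?thesis using entropy_eq_fibre_rate[of x Q] x01 Q2 by simp
    qed
    \<comment> \<open>Keeps the argument of the ceiling in \<open>k\<close> non-negative, so that
      passing to \<open>nat\<close> does not change its value.\<close>
    have h1: "entropy Q x \<le> 1"
    proof -
      have "x / (real Q - 1) > 0" using x01 Q2 by simp
      hence "fibre_rate Q (x / (real Q - 1)) (1 - x) Q \<le> ln Q"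
        using x01 Q2 by (intro fibre_rate_top_le_ln) auto
      thus ?thesis using entropy_eq_fibre_rate[of x Q] x01 Q2 by simp
    qed
    define k where "k = nat \<lceil>n * (1 - entropy Q x)\<rceil>"
    have k: "n * (1 - entropy Q x) \<le> k" "k \<le> n * (1 - entropy Q x) + 1"
    proof -
      have "0 \<le> n * (1 - entropy Q x)" using h1 by simp
      thus "n * (1 - entropy Q x) \<le> k" "k \<le> n * (1 - entropy Q x) + 1"
        unfolding k_def by linarith+
    qed
    define m where "m = nat \<lceil>log 2 n\<rceil>"
    have m: "real n \<le> 2 ^ m" "m \<le> log 2 n + 1"
    proof -
      have l0: "0 \<le> log 2 n" using n3 by simp
      have "real n = 2 powr (log 2 n)" using n3 by simp
      also have "\<dots> \<le> 2 powr m" unfolding m_def by (intro powr_mono) linarith+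
      finally show "real n \<le> 2 ^ m" by (simp add: powr_realpow)
      show "m \<le> log 2 n + 1" unfolding m_def using l0 by linarith
    qed
    \<comment> \<open>Chosen so that \<open>2 ^ s = 2 ^ A * (2 ^ m) ^ (Q + 1)\<close> exceeds
      \<open>c * n ^ (Q + 1)\<close>, while \<open>s\<close> stays logarithmic in
      \<open>n\<close>.\<close>
    define s where "s = A + (Q + 1) * m"
    have "(2 ^ Q * Q * (exp 1 * n) ^ Q) * n * ln Q = c * real n ^ (Q + 1)"
      by (simp add: c_def power_mult_distrib mult_ac)
    also have "\<dots> < 2 ^ A * real n ^ (Q + 1)" using A n3 by (intro mult_strict_right_mono) auto
    also have "\<dots> \<le> 2 ^ A * (2 ^ m) ^ (Q + 1)" using m by (intro mult_left_mono power_mono) auto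
    also have "\<dots> = 2 ^ s" by (simp add: s_def power_add power_mult mult.commute[of _ m] flip: power_mult)
    finally have s: "(2 ^ Q * Q * (exp 1 * n) ^ Q) * n * ln Q < 2 ^ s" .
    obtain C :: "'a vec set" where C: "linear_code n C" "covering_radius t n C \<le> n - b" "code_dim n C \<le> k + t * s"
      using exists_code[where 'a='a and t=t and a=a and b=b and n=n and k=k and s=s] a1 b1 n_eq k s Q2 h
      unfolding assms(1) Q_def[symmetric] by auto
    have "real (covering_radius t n C) \<le> \<theta> * real n"
      using C(2) nb by linarith
    moreover have "real (code_dim n C) \<le> real n * (1 - entropy Q \<theta>) + (K0 + K1) * ln (real n)"
    proof -
      have ln1: "1 \<le> ln (real n)"
      proof -
        have "exp 1 \<le> real n" using exp_le n3 by linarith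
        thus ?thesis using n3 by (subst ln_ge_iff) auto
      qed
      have "real (code_dim n C) \<le> real k + real t * real s"
        using C(3) by (simp flip: of_nat_mult of_nat_add)
      also have "\<dots> \<le> (n * (1 - entropy Q x) + 1) + real t * (A + (real Q + 1) * (log 2 n + 1))"
      proof (intro add_mono mult_left_mono k(2))
        have "real s = A + (real Q + 1) * m" by (simp add: s_def algebra_simps)
        also have "\<dots> \<le> A + (real Q + 1) * (log 2 n + 1)"
          by (intro add_left_mono mult_left_mono m(2)) simp
        finally show "real s \<le> A + (real Q + 1) * (log 2 n + 1)" .
      qed simp
      also have "n * (1 - entropy Q x) \<le> n * (1 - entropy Q \<theta>) + L * (real Q - 1)"
      proof -
        have "n * (entropy Q \<theta> - entropy Q x) \<le> n * (L * (\<theta> - x))"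
          unfolding L_def using x01 x \<theta> Q2 by (intro mult_left_mono entropy_increment_le) auto
        also have "\<dots> = L * (n * (\<theta> - x))" by simp
        also have "\<dots> \<le> L * (real Q - 1)" using L x by (intro mult_left_mono) auto
        finally show ?thesis by (simp add: algebra_simps)
      qed
      also have "n * (1 - entropy Q \<theta>) + L * (real Q - 1) + 1 + real t * (A + (real Q + 1) * (log 2 n + 1))
          = n * (1 - entropy Q \<theta>) + (K0 + K1 * ln n)"
        by (simp add: K0_def K1_def log_def algebra_simps add_divide_distrib)
      also have "K0 \<le> K0 * ln n" using mult_left_mono[OF ln1 K0] by simp
      finally show ?thesis by (simp add: algebra_simps)
    qed
    ultimately show "\<exists>C :: 'a vec set. linear_code n C \<and> real (covering_radius t n C) \<le> \<theta> * real n \<and>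
        real (code_dim n C) \<le> real n * (1 - entropy (q ^ t) \<theta>) + (K0 + K1) * ln (real n)"
      using C(1) unfolding Q_def by blast
  qed
qed

end
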